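(* Let $\mathcal C$ be a representable symmetric monoidal closed category, and consider the PCM structure on its hom-sets induced by the summability structure $(D\multimap-,(\pi_i),\Sigma,0)$. Then this PCM structure is compatible with the symmetric monoidal product, with the symmetric monoidal closed structure, and with the cartesian products (finite or countable) whenever they exist.
   Context: PCM: a nonempty set with a partial sum on countably indexed families ("summable" families) satisfying (Unary) singletons $(x)$ are summable with sum $x$, and (WPA) for summable $(x_a)_{a\in A}$ and a countable partition $\{A_i\}_{i\in I}$ of $A$ (parts possibly empty), each $(x_a)_{a\in A_i}$ is summable and $(\sum_{a\in A_i}x_a)_i$ is summable with sum $\sum_{a\in A}x_a$. $\mathcal C$ is symmetric monoidal closed with zero morphisms $0$ absorbing for $\otimes$. A summation object is $D$ with jointly epic $\iota_i:1\to D$ ($i\in\mathbb N$) and $\Delta:1\to D$; $\pi_i=\mathrm{ev}\circ((D\multimap X)\otimes\iota_i)\circ\rho^{-1}$ and $\Sigma=\mathrm{ev}\circ((D\multimap X)\otimes\Delta)\circ\rho^{-1}:(D\multimap X)\to X$, $\rho$ the right unitor. A summability structure is $(S,(\pi_i),\Sigma,0)$ with $S$ an endofunctor, $\pi_i,\Sigma:S\Rightarrow\mathrm{Id}$ natural, $\pi_i$ jointly monic, and PCM structures on hom-sets with: for every $n\ge1$ a family $(f_{i_1,\dots,i_n})$ in $\mathcal C(X,Y)$ is summable iff some $f:X\to S^nY$ has $\pi_{i_1}\circ\cdots\circ\pi_{i_n}\circ f=f_{i_1,\dots,i_n}$, the sum then being $\Sigma^{\circ n}\circ f$; the empty sum is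 $0$. $\mathcal C$ is representable if it has a summation object $D$ making $(D\multimap-,(\pi_i),\Sigma,0)$ a summability structure. Notation: $e\sqsubseteq e'$ means if $e$ is defined so is $e'$ and they are equal; $e\equiv e'$ means both. Compatibility with $\otimes$: for summable $(f_a)$, $(g_b)$, $(\sum_a f_a)\otimes(\sum_b g_b)\sqsubseteq\sum_{(a,b)}f_a\otimes g_b$. With the closed structure: compatible with $\otimes$ and $\sum_a\mathrm{cur}(f_a)\equiv\mathrm{cur}(\sum_a f_a)$ for families in $\mathcal C(X\otimes Y,Z)$. With $I$-indexed products: $\sum_a\langle f^i_a\rangle_{i\in I}\equiv\langle\sum_a f^i_a\rangle_{i\in I}$ for families $(f^i_a)_a$ in $\mathcal C(X,Y_i)$. *)

theory Defs
  imports Main "HOL-Library.Countable_Set"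
begin

section \<open>Partial commutative monoids\<close>

text \<open>
  A partial sum takes an index set and a family and returns \<^const>\<open>None\<close> when the family is not
  summable. The primitive index sets are the sets of natural numbers: together with
  (Unary) and (WPA) this determines the sum of families over arbitrary countable index sets,
  because sums are invariant under reindexing (lemmas \<open>pcm_reindex\<close>, \<open>csum_reindex\<close>, \<open>csum_nat\<close>
  below).
\<close>

type_synonym 'm psum = "nat set \<Rightarrow> (nat \<Rightarrow> 'm) \<Rightarrow> 'm option"

locale pcm =
  fixes M :: "'m set" and S :: "'m psum"
  assumes nonempty: "M \<noteq> {}"
    and sum_closed: "S A x = Some s \<Longrightarrow> x ` A \<subseteq> M \<and> s \<in> M"
    and sum_cong: "(\<And>a. a \<in> A \<Longrightarrow> x a = y a) \<Longrightarrow> S A x = S A y"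
    and unary: "x a \<in> M \<Longrightarrow> S {a} x = Some (x a)"
    and WPA: "\<lbrakk>S A x = Some s; (\<Union>i\<in>I. P i) = A;
               \<And>i j. \<lbrakk>i \<in> I; j \<in> I; i \<noteq> j\<rbrakk> \<Longrightarrow> P i \<inter> P j = {}\<rbrakk>
              \<Longrightarrow> \<exists>t. (\<forall>i\<in>I. S (P i) x = Some (t i)) \<and> S I t = Some s"

text \<open>The sum of a family over a countable index set of any type.\<close>

definition csum :: "'m psum \<Rightarrow> 'a set \<Rightarrow> ('a \<Rightarrow> 'm) \<Rightarrow> 'm option" where
  "csum S A x = S (to_nat_on A ` A) (\<lambda>n. x (from_nat_into A n))"

lemma (in pcm) pcm_reindex_le:
  assumes b: "bij_betw \<phi> I A" and s: "S A x = Some s"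
  shows "S I (x \<circ> \<phi>) = Some s"
proof -
  have "(\<Union>i\<in>I. {\<phi> i}) = A" using b by (auto simp: bij_betw_def)
  moreover have "\<And>i j. \<lbrakk>i \<in> I; j \<in> I; i \<noteq> j\<rbrakk> \<Longrightarrow> {\<phi> i} \<inter> {\<phi> j} = {}"
    using b by (auto simp: bij_betw_def inj_on_def)
  ultimately obtain t where t: "\<forall>i\<in>I. S {\<phi> i} x = Some (t i)" "S I t = Some s"
    using WPA[OF s, of "\<lambda>i. {\<phi> i}" I] by blast
  have "t i = (x \<circ> \<phi>) i" if "i \<in> I" for i
  proof -
    have "x (\<phi> i) \<in> M" using sum_closed[OF s] b that by (auto simp: bij_betw_def)
    then show ?thesis using unary t that by fastforce
  qed
  then show ?thesis using t(2) sum_cong by metis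
qed

lemma (in pcm) pcm_reindex:
  assumes b: "bij_betw \<phi> I A"
  shows "S I (x \<circ> \<phi>) = S A x"
proof (cases "S A x")
  case (Some s)
  then show ?thesis using pcm_reindex_le[OF b] by simp
next
  case None
  let ?\<psi> = "inv_into I \<phi>"
  have b': "bij_betw ?\<psi> A I" by (rule bij_betw_inv_into[OF b])
  have "S A (x \<circ> \<phi> \<circ> ?\<psi>) = S A x"
    by (rule sum_cong) (use b in \<open>auto simp: bij_betw_inv_into_right\<close>)
  then show ?thesis using pcm_reindex_le[OF b', of "x \<circ> \<phi>"] None
    by (cases "S I (x \<circ> \<phi>)") auto
qed

lemma (in pcm) csum_reindex:
  assumes b: "bij_betw \<phi> I A" and A: "countable A"
  shows "csum S I (x \<circ> \<phi>) = csum S A x"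
proof -
  have I: "countable I" using b A by simp
  let ?I = "to_nat_on I ` I" and ?A = "to_nat_on A ` A"
  let ?\<theta> = "\<lambda>n. to_nat_on A (\<phi> (from_nat_into I n))"
  have 1: "bij_betw (to_nat_on A) A ?A" using A by (simp add: inj_on_imp_bij_betw inj_on_to_nat_on)
  have "bij_betw (from_nat_into I) ?I I"
    by (rule bij_betw_byWitness[where f' = "to_nat_on I"]) (use I in auto)
  from bij_betw_trans[OF bij_betw_trans[OF this b] 1]
  have \<theta>: "bij_betw ?\<theta> ?I ?A" by (simp add: o_def)
  have "S ?I ((\<lambda>n. x (from_nat_into A n)) \<circ> ?\<theta>) = S ?I (\<lambda>n. (x \<circ> \<phi>) (from_nat_into I n))"
    by (rule sum_cong) (use A I b in \<open>auto simp: bij_betw_def\<close>)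
  then show ?thesis unfolding csum_def using pcm_reindex[OF \<theta>] by simp
qed

lemma (in pcm) csum_nat: "csum S A x = S A x"
proof -
  have "bij_betw (from_nat_into A) (to_nat_on A ` A) A"
    by (rule bij_betw_byWitness[where f' = "to_nat_on A"]) auto
  from pcm_reindex[OF this] show ?thesis by (simp add: csum_def o_def)
qed

text \<open>Comparison of possibly undefined expressions.\<close>

definition kleene_le :: "'m option \<Rightarrow> 'm option \<Rightarrow> bool" (infix "\<sqsubseteq>" 50) where
  "e \<sqsubseteq> e' \<longleftrightarrow> (\<forall>v. e = Some v \<longrightarrow> e' = Some v)"

definition kleene_eq :: "'m option \<Rightarrow> 'm option \<Rightarrow> bool" (infix "\<simeq>" 50) where
  "e \<simeq> e' \<longleftrightarrow> e \<sqsubseteq> e' \<and> e' \<sqsubseteq> e"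


section \<open>Symmetric monoidal closed categories with zero morphisms\<close>

record ('o, 'm) cat =
  Ob :: "'o set"
  Arr :: "'m set"
  Dom :: "'m \<Rightarrow> 'o"
  Cod :: "'m \<Rightarrow> 'o"
  Idt :: "'o \<Rightarrow> 'm"
  Comp :: "'m \<Rightarrow> 'm \<Rightarrow> 'm" (infixr "\<cdot>\<index>" 65)

definition Hom :: "('o, 'm, 'z) cat_scheme \<Rightarrow> 'o \<Rightarrow> 'o \<Rightarrow> 'm set" where
  "Hom C X Y = {f \<in> Arr C. Dom C f = X \<and> Cod C f = Y}"

locale category =
  fixes C :: "('o, 'm, 'z) cat_scheme" (structure)
  assumes Dom_Ob: "f \<in> Arr C \<Longrightarrow> Dom C f \<in> Ob C"
    and Cod_Ob: "f \<in> Arr C \<Longrightarrow> Cod C f \<in> Ob C"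
    and Idt_Hom: "X \<in> Ob C \<Longrightarrow> Idt C X \<in> Hom C X X"
    and Comp_Hom: "\<lbrakk>f \<in> Hom C X Y; g \<in> Hom C Y Z\<rbrakk> \<Longrightarrow> g \<cdot> f \<in> Hom C X Z"
    and Comp_Idt: "f \<in> Hom C X Y \<Longrightarrow> f \<cdot> Idt C X = f"
    and Idt_Comp: "f \<in> Hom C X Y \<Longrightarrow> Idt C Y \<cdot> f = f"
    and Comp_assoc: "\<lbrakk>f \<in> Hom C W X; g \<in> Hom C X Y; h \<in> Hom C Y Z\<rbrakk>
                     \<Longrightarrow> (h \<cdot> g) \<cdot> f = h \<cdot> (g \<cdot> f)"

definition inverse_arrows :: "('o, 'm, 'z) cat_scheme \<Rightarrow> 'm \<Rightarrow> 'm \<Rightarrow> bool" where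
  "inverse_arrows C f g \<longleftrightarrow> f \<in> Arr C \<and> g \<in> Hom C (Cod C f) (Dom C f) \<and>
     Comp C g f = Idt C (Dom C f) \<and> Comp C f g = Idt C (Cod C f)"

definition iso :: "('o, 'm, 'z) cat_scheme \<Rightarrow> 'm \<Rightarrow> bool" where
  "iso C f \<longleftrightarrow> (\<exists>g. inverse_arrows C f g)"

definition inverse_of :: "('o, 'm, 'z) cat_scheme \<Rightarrow> 'm \<Rightarrow> 'm" where
  "inverse_of C f = (THE g. inverse_arrows C f g)"

text \<open>
  \<open>Ev C Y Z\<close> is the evaluation \<open>(Y \<leadsto> Z) \<otimes> Y \<rightarrow> Z\<close>, where \<open>Y \<leadsto> Z\<close> denotes the internal hom;
  \<open>Zero C X Y\<close> is the zero morphism \<open>X \<rightarrow> Y\<close>.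
\<close>

record ('o, 'm) smcc = "('o, 'm) cat" +
  TensOb :: "'o \<Rightarrow> 'o \<Rightarrow> 'o" (infixr "\<odot>\<index>" 70)
  Tens :: "'m \<Rightarrow> 'm \<Rightarrow> 'm" (infixr "\<otimes>\<index>" 70)
  Unit :: "'o"
  Assoc :: "'o \<Rightarrow> 'o \<Rightarrow> 'o \<Rightarrow> 'm"
  LUnit :: "'o \<Rightarrow> 'm"
  RUnit :: "'o \<Rightarrow> 'm"
  Sym :: "'o \<Rightarrow> 'o \<Rightarrow> 'm"
  IHom :: "'o \<Rightarrow> 'o \<Rightarrow> 'o" (infixr "\<leadsto>\<index>" 75)
  Ev :: "'o \<Rightarrow> 'o \<Rightarrow> 'm"
  Zero :: "'o \<Rightarrow> 'o \<Rightarrow> 'm"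

locale symmetric_monoidal_category = category C
  for C :: "('o, 'm, 'z) smcc_scheme" (structure) +
  assumes TensOb_Ob: "\<lbrakk>X \<in> Ob C; Y \<in> Ob C\<rbrakk> \<Longrightarrow> X \<odot> Y \<in> Ob C"
    and Tens_Hom: "\<lbrakk>f \<in> Hom C X Y; g \<in> Hom C X' Y'\<rbrakk> \<Longrightarrow> f \<otimes> g \<in> Hom C (X \<odot> X') (Y \<odot> Y')"
    and Tens_Idt: "\<lbrakk>X \<in> Ob C; Y \<in> Ob C\<rbrakk> \<Longrightarrow> Idt C X \<otimes> Idt C Y = Idt C (X \<odot> Y)"
    and Tens_Comp: "\<lbrakk>f \<in> Hom C X Y; g \<in> Hom C Y Z; f' \<in> Hom C X' Y'; g' \<in> Hom C Y' Z'\<rbrakk>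
                    \<Longrightarrow> (g \<cdot> f) \<otimes> (g' \<cdot> f') = (g \<otimes> g') \<cdot> (f \<otimes> f')"
    and Unit_Ob: "Unit C \<in> Ob C"
    and Assoc_Hom: "\<lbrakk>X \<in> Ob C; Y \<in> Ob C; Z \<in> Ob C\<rbrakk>
                    \<Longrightarrow> Assoc C X Y Z \<in> Hom C ((X \<odot> Y) \<odot> Z) (X \<odot> (Y \<odot> Z))"
    and Assoc_iso: "\<lbrakk>X \<in> Ob C; Y \<in> Ob C; Z \<in> Ob C\<rbrakk> \<Longrightarrow> iso C (Assoc C X Y Z)"
    and Assoc_nat: "\<lbrakk>f \<in> Hom C X X'; g \<in> Hom C Y Y'; h \<in> Hom C Z Z'\<rbrakk>
                    \<Longrightarrow> Assoc C X' Y' Z' \<cdot> ((f \<otimes> g) \<otimes> h) = (f \<otimes> (g \<otimes> h)) \<cdot> Assoc C X Y Z"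
    and LUnit_Hom: "X \<in> Ob C \<Longrightarrow> LUnit C X \<in> Hom C (Unit C \<odot> X) X"
    and LUnit_iso: "X \<in> Ob C \<Longrightarrow> iso C (LUnit C X)"
    and LUnit_nat: "f \<in> Hom C X Y \<Longrightarrow> LUnit C Y \<cdot> (Idt C (Unit C) \<otimes> f) = f \<cdot> LUnit C X"
    and RUnit_Hom: "X \<in> Ob C \<Longrightarrow> RUnit C X \<in> Hom C (X \<odot> Unit C) X"
    and RUnit_iso: "X \<in> Ob C \<Longrightarrow> iso C (RUnit C X)"
    and RUnit_nat: "f \<in> Hom C X Y \<Longrightarrow> RUnit C Y \<cdot> (f \<otimes> Idt C (Unit C)) = f \<cdot> RUnit C X"
    and Sym_Hom: "\<lbrakk>X \<in> Ob C; Y \<in> Ob C\<rbrakk> \<Longrightarrow> Sym C X Y \<in> Hom C (X \<odot> Y) (Y \<odot> X)"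
    and Sym_nat: "\<lbrakk>f \<in> Hom C X X'; g \<in> Hom C Y Y'\<rbrakk>
                  \<Longrightarrow> Sym C X' Y' \<cdot> (f \<otimes> g) = (g \<otimes> f) \<cdot> Sym C X Y"
    and Sym_Sym: "\<lbrakk>X \<in> Ob C; Y \<in> Ob C\<rbrakk> \<Longrightarrow> Sym C Y X \<cdot> Sym C X Y = Idt C (X \<odot> Y)"
    and pentagon: "\<lbrakk>W \<in> Ob C; X \<in> Ob C; Y \<in> Ob C; Z \<in> Ob C\<rbrakk> \<Longrightarrow>
        Assoc C W X (Y \<odot> Z) \<cdot> Assoc C (W \<odot> X) Y Z =
        (Idt C W \<otimes> Assoc C X Y Z) \<cdot> Assoc C W (X \<odot> Y) Z \<cdot> (Assoc C W X Y \<otimes> Idt C Z)"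
    and triangle: "\<lbrakk>X \<in> Ob C; Y \<in> Ob C\<rbrakk> \<Longrightarrow>
        (Idt C X \<otimes> LUnit C Y) \<cdot> Assoc C X (Unit C) Y = RUnit C X \<otimes> Idt C Y"
    and hexagon: "\<lbrakk>X \<in> Ob C; Y \<in> Ob C; Z \<in> Ob C\<rbrakk> \<Longrightarrow>
        Assoc C Y Z X \<cdot> Sym C X (Y \<odot> Z) \<cdot> Assoc C X Y Z =
        (Idt C Y \<otimes> Sym C X Z) \<cdot> Assoc C Y X Z \<cdot> (Sym C X Y \<otimes> Idt C Z)"

locale symmetric_monoidal_closed_category = symmetric_monoidal_category C
  for C :: "('o, 'm, 'z) smcc_scheme" (structure) +
  assumes IHom_Ob: "\<lbrakk>Y \<in> Ob C; Z \<in> Ob C\<rbrakk> \<Longrightarrow> Y \<leadsto> Z \<in> Ob C"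
    and Ev_Hom: "\<lbrakk>Y \<in> Ob C; Z \<in> Ob C\<rbrakk> \<Longrightarrow> Ev C Y Z \<in> Hom C ((Y \<leadsto> Z) \<odot> Y) Z"
    and cur_ex1: "\<lbrakk>X \<in> Ob C; Y \<in> Ob C; Z \<in> Ob C; f \<in> Hom C (X \<odot> Y) Z\<rbrakk> \<Longrightarrow>
        \<exists>!h. h \<in> Hom C X (Y \<leadsto> Z) \<and> Ev C Y Z \<cdot> (h \<otimes> Idt C Y) = f"

text \<open>The transpose of \<open>f : X \<otimes> Y \<rightarrow> Z\<close>; it depends on the chosen decomposition of its domain.\<close>

definition cur :: "('o, 'm, 'z) smcc_scheme \<Rightarrow> 'o \<Rightarrow> 'o \<Rightarrow> 'm \<Rightarrow> 'm" where
  "cur C X Y f = (THE h. h \<in> Hom C X (IHom C Y (Cod C f)) \<and>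
                     Comp C (Ev C Y (Cod C f)) (Tens C h (Idt C Y)) = f)"

locale smcc_with_zero = symmetric_monoidal_closed_category C
  for C :: "('o, 'm, 'z) smcc_scheme" (structure) +
  assumes Zero_Hom: "\<lbrakk>X \<in> Ob C; Y \<in> Ob C\<rbrakk> \<Longrightarrow> Zero C X Y \<in> Hom C X Y"
    and Comp_Zero: "\<lbrakk>X \<in> Ob C; f \<in> Hom C Y Z\<rbrakk> \<Longrightarrow> f \<cdot> Zero C X Y = Zero C X Z"
    and Zero_Comp: "\<lbrakk>f \<in> Hom C X Y; Z \<in> Ob C\<rbrakk> \<Longrightarrow> Zero C Y Z \<cdot> f = Zero C X Z"
    and Tens_Zero: "\<lbrakk>f \<in> Hom C X Y; X' \<in> Ob C; Y' \<in> Ob C\<rbrakk>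
                    \<Longrightarrow> f \<otimes> Zero C X' Y' = Zero C (X \<odot> X') (Y \<odot> Y')"
    and Zero_Tens: "\<lbrakk>f \<in> Hom C X Y; X' \<in> Ob C; Y' \<in> Ob C\<rbrakk>
                    \<Longrightarrow> Zero C X' Y' \<otimes> f = Zero C (X' \<odot> X) (Y' \<odot> Y)"


section \<open>Summability structures\<close>

text \<open>
  For an endofunctor with object part \<open>So\<close>, \<open>iter_proj\<close> is the component at \<open>Y\<close> of
  \<open>\<pi>\<^sub>i\<^sub>1 \<circ> \<dots> \<circ> \<pi>\<^sub>i\<^sub>n : S\<^sup>n Y \<rightarrow> Y\<close> and \<open>iter_sum\<close> that of \<open>\<Sigma> \<circ> \<dots> \<circ> \<Sigma>\<close>; the leftmost factor is the
  component at \<open>Y\<close>, the next one the component at \<open>S Y\<close>, and so on.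
\<close>

primrec iter_proj ::
  "('o, 'm, 'z) cat_scheme \<Rightarrow> ('o \<Rightarrow> 'o) \<Rightarrow> (nat \<Rightarrow> 'o \<Rightarrow> 'm) \<Rightarrow> nat list \<Rightarrow> 'o \<Rightarrow> 'm" where
  "iter_proj C So \<pi> [] Y = Idt C Y"
| "iter_proj C So \<pi> (i # is) Y = Comp C (\<pi> i Y) (iter_proj C So \<pi> is (So Y))"

primrec iter_sum ::
  "('o, 'm, 'z) cat_scheme \<Rightarrow> ('o \<Rightarrow> 'o) \<Rightarrow> ('o \<Rightarrow> 'm) \<Rightarrow> nat \<Rightarrow> 'o \<Rightarrow> 'm" where
  "iter_sum C So \<sigma> 0 Y = Idt C Y"
| "iter_sum C So \<sigma> (Suc n) Y = Comp C (\<sigma> Y) (iter_sum C So \<sigma> n (So Y))"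

text \<open>
  \<open>So\<close> and \<open>Sa\<close> are the object and arrow parts of the endofunctor, and \<open>PS X Y\<close> is the PCM
  structure on \<open>Hom C X Y\<close>. Families indexed by \<open>n\<close>-tuples are indexed by lists of length \<open>n\<close>.
\<close>

locale summability_structure = smcc_with_zero C
  for C :: "('o, 'm, 'z) smcc_scheme" (structure) +
  fixes So :: "'o \<Rightarrow> 'o" and Sa :: "'m \<Rightarrow> 'm"
    and \<pi> :: "nat \<Rightarrow> 'o \<Rightarrow> 'm" and \<sigma> :: "'o \<Rightarrow> 'm"
    and PS :: "'o \<Rightarrow> 'o \<Rightarrow> 'm psum"
  assumes So_Ob: "X \<in> Ob C \<Longrightarrow> So X \<in> Ob C"
    and Sa_Hom: "f \<in> Hom C X Y \<Longrightarrow> Sa f \<in> Hom C (So X) (So Y)"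
    and Sa_Idt: "X \<in> Ob C \<Longrightarrow> Sa (Idt C X) = Idt C (So X)"
    and Sa_Comp: "\<lbrakk>f \<in> Hom C X Y; g \<in> Hom C Y Z\<rbrakk> \<Longrightarrow> Sa (g \<cdot> f) = Sa g \<cdot> Sa f"
    and proj_Hom: "X \<in> Ob C \<Longrightarrow> \<pi> i X \<in> Hom C (So X) X"
    and proj_nat: "f \<in> Hom C X Y \<Longrightarrow> \<pi> i Y \<cdot> Sa f = f \<cdot> \<pi> i X"
    and sum_Hom: "X \<in> Ob C \<Longrightarrow> \<sigma> X \<in> Hom C (So X) X"
    and sum_nat: "f \<in> Hom C X Y \<Longrightarrow> \<sigma> Y \<cdot> Sa f = f \<cdot> \<sigma> X"
    and proj_jointly_monic:
      "\<lbrakk>Y \<in> Ob C; f \<in> Hom C X (So Y); g \<in> Hom C X (So Y); \<And>i. \<pi> i Y \<cdot> f = \<pi> i Y \<cdot> g\<rbrakk> \<Longrightarrow> f = g"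
    and PS_pcm: "\<lbrakk>X \<in> Ob C; Y \<in> Ob C\<rbrakk> \<Longrightarrow> pcm (Hom C X Y) (PS X Y)"
    and PS_summable_iff:
      "\<lbrakk>X \<in> Ob C; Y \<in> Ob C; n \<ge> 1; \<And>is. length is = n \<Longrightarrow> F is \<in> Hom C X Y\<rbrakk> \<Longrightarrow>
        (csum (PS X Y) {is. length is = n} F \<noteq> None) \<longleftrightarrow>
        (\<exists>h \<in> Hom C X ((So ^^ n) Y). \<forall>is. length is = n \<longrightarrow> iter_proj C So \<pi> is Y \<cdot> h = F is)"
    and PS_sum:
      "\<lbrakk>X \<in> Ob C; Y \<in> Ob C; n \<ge> 1; \<And>is. length is = n \<Longrightarrow> F is \<in> Hom C X Y;
        h \<in> Hom C X ((So ^^ n) Y); \<And>is. length is = n \<Longrightarrow> iter_proj C So \<pi> is Y \<cdot> h = F is\<rbrakk> \<Longrightarrow>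
        csum (PS X Y) {is. length is = n} F = Some (iter_sum C So \<sigma> n Y \<cdot> h)"
    and PS_empty: "\<lbrakk>X \<in> Ob C; Y \<in> Ob C\<rbrakk> \<Longrightarrow> PS X Y {} x = Some (Zero C X Y)"


section \<open>Representability\<close>

locale summation_object = smcc_with_zero C
  for C :: "('o, 'm, 'z) smcc_scheme" (structure) +
  fixes D :: 'o and \<iota> :: "nat \<Rightarrow> 'm" and \<Delta> :: 'm
  assumes D_Ob: "D \<in> Ob C"
    and inj_Hom: "\<iota> i \<in> Hom C (Unit C) D"
    and inj_jointly_epic:
      "\<lbrakk>f \<in> Hom C D X; g \<in> Hom C D X; \<And>i. f \<cdot> \<iota> i = g \<cdot> \<iota> i\<rbrakk> \<Longrightarrow> f = g"
    and Delta_Hom: "\<Delta> \<in> Hom C (Unit C) D"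

text \<open>The action of \<open>D \<leadsto> -\<close> on arrows.\<close>

definition IHom_arr :: "('o, 'm, 'z) smcc_scheme \<Rightarrow> 'o \<Rightarrow> 'm \<Rightarrow> 'm" where
  "IHom_arr C D f = cur C (IHom C D (Dom C f)) D (Comp C f (Ev C D (Dom C f)))"

text \<open>Evaluation at a point \<open>p : 1 \<rightarrow> D\<close>, that is \<open>ev \<circ> ((D \<leadsto> X) \<otimes> p) \<circ> \<rho>\<^sup>-\<^sup>1 : (D \<leadsto> X) \<rightarrow> X\<close>.\<close>

definition ev_at :: "('o, 'm, 'z) smcc_scheme \<Rightarrow> 'o \<Rightarrow> 'm \<Rightarrow> 'o \<Rightarrow> 'm" where
  "ev_at C D p X = Comp C (Ev C D X)
     (Comp C (Tens C (Idt C (IHom C D X)) p) (inverse_of C (RUnit C (IHom C D X))))"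

text \<open>
  A representable category, together with a witnessing summation object and the induced PCM
  structure on its hom-sets.
\<close>

locale representable_smcc =
  summation_object C D \<iota> \<Delta> +
  summability_structure C "IHom C D" "IHom_arr C D" "\<lambda>i. ev_at C D (\<iota> i)" "ev_at C D \<Delta>" PS
  for C :: "('o, 'm, 'z) smcc_scheme" (structure)
    and D :: 'o and \<iota> :: "nat \<Rightarrow> 'm" and \<Delta> :: 'm and PS :: "'o \<Rightarrow> 'o \<Rightarrow> 'm psum"


section \<open>Cartesian products\<close>

definition is_product ::
  "('o, 'm, 'z) cat_scheme \<Rightarrow> 'i set \<Rightarrow> ('i \<Rightarrow> 'o) \<Rightarrow> 'o \<Rightarrow> ('i \<Rightarrow> 'm) \<Rightarrow> bool" where
  "is_product C I Y P p \<longleftrightarrow>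
     P \<in> Ob C \<and> (\<forall>i\<in>I. Y i \<in> Ob C \<and> p i \<in> Hom C P (Y i)) \<and>
     (\<forall>X\<in>Ob C. \<forall>f. (\<forall>i\<in>I. f i \<in> Hom C X (Y i)) \<longrightarrow>
        (\<exists>!h. h \<in> Hom C X P \<and> (\<forall>i\<in>I. Comp C (p i) h = f i)))"

definition tuple ::
  "('o, 'm, 'z) cat_scheme \<Rightarrow> 'i set \<Rightarrow> 'o \<Rightarrow> ('i \<Rightarrow> 'm) \<Rightarrow> 'o \<Rightarrow> ('i \<Rightarrow> 'm) \<Rightarrow> 'm" where
  "tuple C I P p X f = (THE h. h \<in> Hom C X P \<and> (\<forall>i\<in>I. Comp C (p i) h = f i))"


section \<open>Compatibility of the PCM structure\<close>

text \<open>
  The type arguments \<^typ>\<open>'a itself\<close>, \<^typ>\<open>'b itself\<close> only name the types from which the index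
  sets of the summed families are taken.
\<close>

definition compatible_with_tensor ::
  "('o, 'm, 'z) smcc_scheme \<Rightarrow> ('o \<Rightarrow> 'o \<Rightarrow> 'm psum) \<Rightarrow> 'a itself \<Rightarrow> 'b itself \<Rightarrow> bool" where
  "compatible_with_tensor C PS _ _ \<longleftrightarrow>
     (\<forall>X\<in>Ob C. \<forall>Y\<in>Ob C. \<forall>X'\<in>Ob C. \<forall>Y'\<in>Ob C. \<forall>(A :: 'a set) (B :: 'b set) f g.
        countable A \<longrightarrow> countable B \<longrightarrow>
        (\<forall>a\<in>A. f a \<in> Hom C X Y) \<longrightarrow> (\<forall>b\<in>B. g b \<in> Hom C X' Y') \<longrightarrow>
        Option.bind (csum (PS X Y) A f)
          (\<lambda>s. Option.bind (csum (PS X' Y') B g) (\<lambda>t. Some (Tens C s t)))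
        \<sqsubseteq> csum (PS (TensOb C X X') (TensOb C Y Y')) (A \<times> B) (\<lambda>(a, b). Tens C (f a) (g b)))"

definition compatible_with_closed ::
  "('o, 'm, 'z) smcc_scheme \<Rightarrow> ('o \<Rightarrow> 'o \<Rightarrow> 'm psum) \<Rightarrow> 'a itself \<Rightarrow> 'b itself \<Rightarrow> bool" where
  "compatible_with_closed C PS TA TB \<longleftrightarrow>
     compatible_with_tensor C PS TA TB \<and>
     (\<forall>X\<in>Ob C. \<forall>Y\<in>Ob C. \<forall>Z\<in>Ob C. \<forall>(A :: 'a set) f.
        countable A \<longrightarrow> (\<forall>a\<in>A. f a \<in> Hom C (TensOb C X Y) Z) \<longrightarrow>
        csum (PS X (IHom C Y Z)) A (\<lambda>a. cur C X Y (f a))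
        \<simeq> map_option (cur C X Y) (csum (PS (TensOb C X Y) Z) A f))"

text \<open>
  The tuple of sums on the right-hand side is defined iff all the component sums are. For an
  index set of cardinality zero this is the statement for a terminal object.
\<close>

definition compatible_with_products ::
  "('o, 'm, 'z) smcc_scheme \<Rightarrow> ('o \<Rightarrow> 'o \<Rightarrow> 'm psum) \<Rightarrow> 'i set \<Rightarrow> 'a itself \<Rightarrow> bool" where
  "compatible_with_products C PS I _ \<longleftrightarrow>
     (\<forall>Y P p. is_product C I Y P p \<longrightarrow>
       (\<forall>X\<in>Ob C. \<forall>(A :: 'a set) f.
          countable A \<longrightarrow> (\<forall>i\<in>I. \<forall>a\<in>A. f i a \<in> Hom C X (Y i)) \<longrightarrow>
          csum (PS X P) A (\<lambda>a. tuple C I P p X (\<lambda>i. f i a))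
          \<simeq> (if \<forall>i\<in>I. csum (PS X (Y i)) A (f i) \<noteq> None
             then Some (tuple C I P p X (\<lambda>i. the (csum (PS X (Y i)) A (f i))))
             else None)))"

end

theory Submission
  imports Defs
begin

text \<open>
  Transposing, a sequence in \<open>\<C>(X, Y)\<close> is summable iff it consists of the composites of a single
  arrow \<open>u : X \<otimes> D \<rightarrow> Y\<close> with the arrows \<open>X \<cong> X \<otimes> 1 \<rightarrow> X \<otimes> D\<close> (\<open>pt\<close> below) given by the points
  \<open>\<iota>\<^sub>i\<close>, and the sum is the composite at the point \<open>\<Delta>\<close>; families over other countable sets are
  extended by zero. So an operation on hom-sets preserves sums as soon as it lifts to such
  witnesses \<open>u\<close>, uniformly in the point: postcomposition does so trivially, and tupling since
  products may be formed on \<open>X \<otimes> D\<close>. For tensoring with an object and for currying one moves \<open>D\<close>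
  past another factor by the canonical isomorphism \<open>(X \<otimes> Y) \<otimes> Z \<cong> (X \<otimes> Z) \<otimes> Y\<close>; that this
  respects points is a matter of coherence of the unit laws. The tensor product of two witnesses
  yields an arrow \<open>((X \<otimes> X') \<otimes> D) \<otimes> D \<rightarrow> Y \<otimes> Y'\<close>, whose double transpose witnesses the
  summability of the double family of tensor products.
\<close>

section \<open>Partial commutative monoids\<close>

context pcm
begin

lemma csum_cong:
  assumes "countable A" "\<And>a. a \<in> A \<Longrightarrow> x a = y a"
  shows "csum S A x = csum S A y"
  unfolding csum_def by (rule sum_cong) (use assms in auto)

lemma csum_mem:
  assumes "csum S A x = Some s" "countable A"
  shows "s \<in> M" "a \<in> A \<Longrightarrow> x a \<in> M"
proof -
  note * = sum_closed[OF assms(1)[unfolded csum_def]]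
  show "s \<in> M" using * by blast
  assume "a \<in> A"
  then show "x a \<in> M" using * assms(2) by (auto simp: image_image)
qed

text \<open>WPA allows empty parts: partition \<open>K\<close> into parts indexed by all of
  \<open>A\<close>, singletons over \<open>K\<close> and the empty set elsewhere. The empty parts
  sum to \<open>z\<close>, which is also the value of the family there.\<close>

lemma sum_extend_le:
  assumes s: "S K x = Some s" and K: "K \<subseteq> A"
    and z: "\<And>x. S {} x = Some z" "\<And>a. a \<in> A - K \<Longrightarrow> x a = z"
  shows "S A x = Some s"
proof -
  let ?P = "\<lambda>a. if a \<in> K then {a} else {}"
  have "(\<Union>a\<in>A. ?P a) = K" using K by auto
  moreover have "\<And>i j. \<lbrakk>i \<in> A; j \<in> A; i \<noteq> j\<rbrakk> \<Longrightarrow> ?P i \<inter> ?P j = {}" by auto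
  ultimately obtain t where t: "\<forall>a\<in>A. S (?P a) x = Some (t a)" "S A t = Some s"
    using WPA[OF s, of ?P A] by blast
  have "t a = x a" if "a \<in> A" for a
  proof (cases "a \<in> K")
    case True
    then have "x a \<in> M" using sum_closed[OF s] by blast
    then show ?thesis using unary[of x a] t(1) that True by auto
  next
    case False
    then show ?thesis using t(1) that z by auto
  qed
  then show ?thesis using t(2) sum_cong by metis
qed

lemma sum_extend:
  assumes K: "K \<subseteq> A"
    and z: "\<And>x. S {} x = Some z" "\<And>a. a \<in> A - K \<Longrightarrow> x a = z"
  shows "S A x = S K x"
proof (cases "S K x")
  case (Some s)
  then show ?thesis using sum_extend_le[OF _ K z] by simp
next
  case None
  show ?thesis
  proof (cases "S A x")
    case (Some s)
    \<comment> \<open>By WPA a subfamily of a summable family is summable, so \<open>S A x\<close>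
      cannot be defined in this case.\<close>
    let ?P = "\<lambda>i::nat. if i = 0 then K else A - K"
    have "(\<Union>i\<in>{0,1}. ?P i) = A" using K by auto
    moreover have "\<And>i j. \<lbrakk>i \<in> {0,1}; j \<in> {0,1}; i \<noteq> j\<rbrakk> \<Longrightarrow> ?P i \<inter> ?P j = {}" by auto
    ultimately obtain t where "\<forall>i\<in>{0,1}. S (?P i) x = Some (t i)"
      using WPA[OF Some, of ?P "{0,1}"] by blast
    then show ?thesis using None by auto
  qed (use None in simp)
qed

lemma csum_extend:
  assumes A: "countable A" and K: "K \<subseteq> A"
    and z: "\<And>x. S {} x = Some z" "\<And>a. a \<in> A - K \<Longrightarrow> x a = z"
  shows "csum S A x = csum S K x"
proof -
  let ?x = "x \<circ> from_nat_into A"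
  \<comment> \<open>The codes that \<open>K\<close> inherits from the enumeration of
    \<open>A\<close> need not be those that \<open>csum\<close> assigns to \<open>K\<close>; this
    bijection reconciles the two.\<close>
  have b: "bij_betw (from_nat_into A) (to_nat_on A ` K) K"
    by (rule bij_betw_byWitness[where f' = "to_nat_on A"]) (use A K in auto)
  have "csum S A x = S (to_nat_on A ` A) ?x" by (simp add: csum_def o_def)
  also have "\<dots> = S (to_nat_on A ` K) ?x"
  proof (rule sum_extend[OF _ z(1)])
    show "?x n = z" if n: "n \<in> to_nat_on A ` A - to_nat_on A ` K" for n
    proof -
      obtain a where "n = to_nat_on A a" "a \<in> A - K" using n by blast
      then show ?thesis using A z(2)[of a] by simp
    qed
  qed (use K in blast)
  also have "\<dots> = csum S K x"
    using csum_reindex[OF b] K A countable_subset csum_nat by metis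
  finally show ?thesis .
qed

end


section \<open>Coherence in symmetric monoidal categories\<close>

context category
begin

lemma Comp_arr [simp]:
  assumes "f \<in> Arr C" "g \<in> Arr C" "Dom C g = Cod C f"
  shows "g \<cdot> f \<in> Arr C" "Dom C (g \<cdot> f) = Dom C f" "Cod C (g \<cdot> f) = Cod C g"
  using Comp_Hom[of f "Dom C f" "Cod C f" g "Cod C g"] assms by (auto simp: Hom_def)

lemma Idt_arr [simp]:
  assumes "X \<in> Ob C"
  shows "Idt C X \<in> Arr C" "Dom C (Idt C X) = X" "Cod C (Idt C X) = X"
  using Idt_Hom[OF assms] by (auto simp: Hom_def)

lemma Comp_Idt_arr [simp]: "\<lbrakk>f \<in> Arr C; Dom C f = X\<rbrakk> \<Longrightarrow> f \<cdot> Idt C X = f"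
  using Comp_Idt by (auto simp: Hom_def)

lemma Idt_Comp_arr [simp]: "\<lbrakk>f \<in> Arr C; Cod C f = X\<rbrakk> \<Longrightarrow> Idt C X \<cdot> f = f"
  using Idt_Comp by (auto simp: Hom_def)

text \<open>As a simplification rule this makes right-nested composites the normal form, which is
  why \<open>inverse_of_cancel\<close>, \<open>Tens_Comp_arr_assoc\<close> and
  \<open>Comp_eq_assoc\<close> carry a trailing factor.\<close>

lemma Comp_assoc_arr [simp]:
  "\<lbrakk>f \<in> Arr C; g \<in> Arr C; h \<in> Arr C; Dom C g = Cod C f; Dom C h = Cod C g\<rbrakk>
    \<Longrightarrow> (h \<cdot> g) \<cdot> f = h \<cdot> g \<cdot> f"
  using Comp_assoc by (auto simp: Hom_def)

lemma Ob_arr [simp]: "f \<in> Arr C \<Longrightarrow> Dom C f \<in> Ob C" "f \<in> Arr C \<Longrightarrow> Cod C f \<in> Ob C"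
  using Dom_Ob Cod_Ob by auto

lemma inverse_arrows_inverse_of:
  assumes "iso C f"
  shows "inverse_arrows C f (inverse_of C f)"
proof -
  obtain g where g: "inverse_arrows C f g" using assms by (auto simp: iso_def)
  have "h = g" if h: "inverse_arrows C f h" for h
  proof -
    have "h = h \<cdot> f \<cdot> g" using g h by (simp add: inverse_arrows_def Hom_def)
    also have "\<dots> = (h \<cdot> f) \<cdot> g"
      by (rule Comp_assoc_arr[symmetric]) (use g h in \<open>simp_all add: inverse_arrows_def Hom_def\<close>)
    also have "\<dots> = g" using g h by (simp add: inverse_arrows_def Hom_def del: Comp_assoc_arr)
    finally show ?thesis .
  qed
  then show ?thesis unfolding inverse_of_def by (rule theI[of "inverse_arrows C f", OF g])
qed

lemma inverse_of_arr:
  assumes "iso C f"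
  shows "f \<in> Arr C" "inverse_of C f \<in> Arr C" "Dom C (inverse_of C f) = Cod C f"
    "Cod C (inverse_of C f) = Dom C f"
    "inverse_of C f \<cdot> f = Idt C (Dom C f)" "f \<cdot> inverse_of C f = Idt C (Cod C f)"
  using inverse_arrows_inverse_of[OF assms] by (auto simp: inverse_arrows_def Hom_def)

lemma inverse_of_cancel:
  assumes "iso C f" "g \<in> Arr C"
  shows "Cod C g = Dom C f \<Longrightarrow> inverse_of C f \<cdot> f \<cdot> g = g"
    "Cod C g = Cod C f \<Longrightarrow> f \<cdot> inverse_of C f \<cdot> g = g"
proof -
  note f = inverse_of_arr[OF assms(1)]
  show "inverse_of C f \<cdot> f \<cdot> g = g" if "Cod C g = Dom C f"
    using that f assms(2) Comp_assoc_arr[of g f "inverse_of C f", symmetric]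
    by (simp del: Comp_assoc_arr)
  show "f \<cdot> inverse_of C f \<cdot> g = g" if "Cod C g = Cod C f"
    using that f assms(2) Comp_assoc_arr[of g "inverse_of C f" f, symmetric]
    by (simp del: Comp_assoc_arr)
qed

lemma iso_monic:
  assumes "iso C a" "f \<in> Arr C" "g \<in> Arr C" "Cod C f = Dom C a" "Cod C g = Dom C a"
    and "a \<cdot> f = a \<cdot> g"
  shows "f = g"
  using inverse_of_cancel(1)[OF assms(1)] assms by metis

lemma iso_epic:
  assumes "iso C a" "f \<in> Arr C" "g \<in> Arr C" "Dom C f = Cod C a" "Dom C g = Cod C a"
    and "f \<cdot> a = g \<cdot> a"
  shows "f = g"
proof -
  note a = inverse_of_arr[OF assms(1)]
  have "f = (f \<cdot> a) \<cdot> inverse_of C a" "g = (g \<cdot> a) \<cdot> inverse_of C a"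
    using a assms(2-5) by simp_all
  then show ?thesis using assms(6) by simp
qed

lemma tuple_props:
  assumes "is_product C I Y P p" "X \<in> Ob C" "\<And>i. i \<in> I \<Longrightarrow> f i \<in> Hom C X (Y i)"
  shows "tuple C I P p X f \<in> Hom C X P" "i \<in> I \<Longrightarrow> p i \<cdot> tuple C I P p X f = f i"
proof -
  have "\<exists>!h. h \<in> Hom C X P \<and> (\<forall>i\<in>I. p i \<cdot> h = f i)"
    using assms unfolding is_product_def by blast
  from theI'[OF this] show "tuple C I P p X f \<in> Hom C X P" "i \<in> I \<Longrightarrow> p i \<cdot> tuple C I P p X f = f i"
    unfolding tuple_def by auto
qed

lemma tuple_unique:
  assumes "is_product C I Y P p" "X \<in> Ob C" "h \<in> Hom C X P" "\<And>i. i \<in> I \<Longrightarrow> p i \<cdot> h = f i"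
  shows "tuple C I P p X f = h"
proof -
  have "f i \<in> Hom C X (Y i)" if "i \<in> I" for i
    using that assms Comp_Hom[of h X P "p i" "Y i"] unfolding is_product_def by auto
  then have "\<exists>!h. h \<in> Hom C X P \<and> (\<forall>i\<in>I. p i \<cdot> h = f i)"
    using assms(1,2) unfolding is_product_def by blast
  then show ?thesis unfolding tuple_def by (rule the1_equality) (use assms in auto)
qed

end

context symmetric_monoidal_category
begin

declare TensOb_Ob [simp] Tens_Idt [simp]

lemma Tens_arr [simp]:
  assumes "f \<in> Arr C" "g \<in> Arr C"
  shows "f \<otimes> g \<in> Arr C" "Dom C (f \<otimes> g) = Dom C f \<odot> Dom C g"
    "Cod C (f \<otimes> g) = Cod C f \<odot> Cod C g"
  using Tens_Hom[of f "Dom C f" "Cod C f" g "Dom C g" "Cod C g"] assms by (auto simp: Hom_def)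

lemma structure_arr [simp]:
  "Unit C \<in> Ob C"
  "\<lbrakk>X \<in> Ob C; Y \<in> Ob C; Z \<in> Ob C\<rbrakk> \<Longrightarrow> Assoc C X Y Z \<in> Arr C"
  "\<lbrakk>X \<in> Ob C; Y \<in> Ob C; Z \<in> Ob C\<rbrakk> \<Longrightarrow> Dom C (Assoc C X Y Z) = (X \<odot> Y) \<odot> Z"
  "\<lbrakk>X \<in> Ob C; Y \<in> Ob C; Z \<in> Ob C\<rbrakk> \<Longrightarrow> Cod C (Assoc C X Y Z) = X \<odot> Y \<odot> Z"
  "X \<in> Ob C \<Longrightarrow> LUnit C X \<in> Arr C"
  "X \<in> Ob C \<Longrightarrow> Dom C (LUnit C X) = Unit C \<odot> X"
  "X \<in> Ob C \<Longrightarrow> Cod C (LUnit C X) = X"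
  "X \<in> Ob C \<Longrightarrow> RUnit C X \<in> Arr C"
  "X \<in> Ob C \<Longrightarrow> Dom C (RUnit C X) = X \<odot> Unit C"
  "X \<in> Ob C \<Longrightarrow> Cod C (RUnit C X) = X"
  "\<lbrakk>X \<in> Ob C; Y \<in> Ob C\<rbrakk> \<Longrightarrow> Sym C X Y \<in> Arr C"
  "\<lbrakk>X \<in> Ob C; Y \<in> Ob C\<rbrakk> \<Longrightarrow> Dom C (Sym C X Y) = X \<odot> Y"
  "\<lbrakk>X \<in> Ob C; Y \<in> Ob C\<rbrakk> \<Longrightarrow> Cod C (Sym C X Y) = Y \<odot> X"
  using Unit_Ob Assoc_Hom LUnit_Hom RUnit_Hom Sym_Hom by (auto simp: Hom_def)

lemma structure_inverse_arr [simp]: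
  "\<lbrakk>X \<in> Ob C; Y \<in> Ob C; Z \<in> Ob C\<rbrakk> \<Longrightarrow> inverse_of C (Assoc C X Y Z) \<in> Arr C"
  "\<lbrakk>X \<in> Ob C; Y \<in> Ob C; Z \<in> Ob C\<rbrakk> \<Longrightarrow> Dom C (inverse_of C (Assoc C X Y Z)) = X \<odot> Y \<odot> Z"
  "\<lbrakk>X \<in> Ob C; Y \<in> Ob C; Z \<in> Ob C\<rbrakk> \<Longrightarrow> Cod C (inverse_of C (Assoc C X Y Z)) = (X \<odot> Y) \<odot> Z"
  "X \<in> Ob C \<Longrightarrow> inverse_of C (RUnit C X) \<in> Arr C"
  "X \<in> Ob C \<Longrightarrow> Dom C (inverse_of C (RUnit C X)) = X"
  "X \<in> Ob C \<Longrightarrow> Cod C (inverse_of C (RUnit C X)) = X \<odot> Unit C"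
  using Assoc_iso RUnit_iso by (simp_all add: inverse_of_arr)

lemma Tens_Comp_arr [simp]:
  assumes "f \<in> Arr C" "g \<in> Arr C" "Dom C g = Cod C f"
    and "f' \<in> Arr C" "g' \<in> Arr C" "Dom C g' = Cod C f'"
  shows "(g \<otimes> g') \<cdot> (f \<otimes> f') = (g \<cdot> f) \<otimes> (g' \<cdot> f')"
  using Tens_Comp[of f "Dom C f" "Cod C f" g "Cod C g" f' "Dom C f'" "Cod C f'" g' "Cod C g'"]
    assms by (auto simp: Hom_def)

lemma Tens_Comp_arr_assoc [simp]:
  assumes "f \<in> Arr C" "g \<in> Arr C" "Dom C g = Cod C f"
    and "f' \<in> Arr C" "g' \<in> Arr C" "Dom C g' = Cod C f'"
    and "k \<in> Arr C" "Cod C k = Dom C f \<odot> Dom C f'"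
  shows "(g \<otimes> g') \<cdot> (f \<otimes> f') \<cdot> k = ((g \<cdot> f) \<otimes> (g' \<cdot> f')) \<cdot> k"
  using Comp_assoc_arr[of k "f \<otimes> f'" "g \<otimes> g'"] assms by simp

text \<open>Naturality expresses \<open>f\<close> composed with the right unitor through
  \<open>f \<otimes> Idt C (Unit C)\<close>, and the unitor is epic. Hence equations may be checked
  after tensoring with the unit object.\<close>

lemma Tens_Unit_inject:
  assumes "f \<in> Arr C" "g \<in> Arr C" "Dom C f = Dom C g" "Cod C f = Cod C g"
    and "f \<otimes> Idt C (Unit C) = g \<otimes> Idt C (Unit C)"
  shows "f = g"
  by (rule iso_epic[OF RUnit_iso[of "Dom C f"]])
    (use assms RUnit_nat[of f "Dom C f" "Cod C f"] RUnit_nat[of g "Dom C g" "Cod C g"]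
      in \<open>auto simp: Hom_def\<close>)

lemma Unit_Tens_inject:
  assumes "f \<in> Arr C" "g \<in> Arr C" "Dom C f = Dom C g" "Cod C f = Cod C g"
    and "Idt C (Unit C) \<otimes> f = Idt C (Unit C) \<otimes> g"
  shows "f = g"
  by (rule iso_epic[OF LUnit_iso[of "Dom C f"]])
    (use assms LUnit_nat[of f "Dom C f" "Cod C f"] LUnit_nat[of g "Dom C g" "Cod C g"]
      in \<open>auto simp: Hom_def\<close>)

lemma Assoc_nat_arr:
  assumes "f \<in> Arr C" "g \<in> Arr C" "h \<in> Arr C"
    and "Cod C f = X" "Cod C g = Y" "Cod C h = Z"
  shows "Assoc C X Y Z \<cdot> ((f \<otimes> g) \<otimes> h) =
    (f \<otimes> g \<otimes> h) \<cdot> Assoc C (Dom C f) (Dom C g) (Dom C h)"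
  using Assoc_nat[of f "Dom C f" "Cod C f" g "Dom C g" "Cod C g" h "Dom C h" "Cod C h"]
    assms by (auto simp: Hom_def)

lemma Sym_nat_arr:
  assumes "f \<in> Arr C" "g \<in> Arr C" "Cod C f = X" "Cod C g = Y"
  shows "Sym C X Y \<cdot> (f \<otimes> g) = (g \<otimes> f) \<cdot> Sym C (Dom C f) (Dom C g)"
  using Sym_nat[of f "Dom C f" "Cod C f" g "Dom C g" "Cod C g"] assms by (auto simp: Hom_def)

lemma Comp_eq_assoc:
  assumes "a \<cdot> b = c" "a \<in> Arr C" "b \<in> Arr C" "k \<in> Arr C" "Dom C a = Cod C b" "Dom C b = Cod C k"
  shows "a \<cdot> b \<cdot> k = c \<cdot> k"
  using assms Comp_assoc_arr by metis

lemma iso_Tens: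
  assumes "iso C f" "iso C g"
  shows "iso C (f \<otimes> g)"
  unfolding iso_def inverse_arrows_def
  by (rule exI[of _ "inverse_of C f \<otimes> inverse_of C g"])
    (use inverse_of_arr[OF assms(1)] inverse_of_arr[OF assms(2)] in \<open>simp add: Hom_def\<close>)

lemma iso_Idt: "X \<in> Ob C \<Longrightarrow> iso C (Idt C X)"
  unfolding iso_def inverse_arrows_def by (rule exI[of _ "Idt C X"]) (simp add: Hom_def)

lemma iso_Sym: "\<lbrakk>X \<in> Ob C; Y \<in> Ob C\<rbrakk> \<Longrightarrow> iso C (Sym C X Y)"
  unfolding iso_def inverse_arrows_def
  by (rule exI[of _ "Sym C Y X"]) (simp add: Hom_def Sym_Sym)

text \<open>Kelly's argument: the pentagon with a unit object in one place yields the missing unit laws.\<close>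

lemma RUnit_TensOb:
  assumes X: "X \<in> Ob C" and Y: "Y \<in> Ob C"
  shows "(Idt C X \<otimes> RUnit C Y) \<cdot> Assoc C X Y (Unit C) = RUnit C (X \<odot> Y)"
proof -
  let ?U = "Unit C"
  note [simp] = X Y
  \<comment> \<open>The claim is checked tensored with the unit object and followed by an
    associator. The triangle and naturality of the associator then produce the short side of the
    pentagon at \<open>X\<close>, \<open>Y\<close>, \<open>?U\<close>, \<open>?U\<close>.\<close>
  have "Assoc C X Y ?U \<cdot> (RUnit C (X \<odot> Y) \<otimes> Idt C ?U) =
      Assoc C X Y ?U \<cdot> (Idt C (X \<odot> Y) \<otimes> LUnit C ?U) \<cdot> Assoc C (X \<odot> Y) ?U ?U"
    by (simp add: triangle)
  also have "\<dots> = (Idt C X \<otimes> Idt C Y \<otimes> LUnit C ?U) \<cdot> Assoc C X Y (?U \<odot> ?U) \<cdot> Assoc C (X \<odot> Y) ?U ?U"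
    using Comp_eq_assoc[OF Assoc_nat_arr[of "Idt C X" "Idt C Y" "LUnit C ?U" X Y ?U]] by simp
  also have "\<dots> = (Idt C X \<otimes> ((Idt C Y \<otimes> LUnit C ?U) \<cdot> Assoc C Y ?U ?U)) \<cdot>
      Assoc C X (Y \<odot> ?U) ?U \<cdot> (Assoc C X Y ?U \<otimes> Idt C ?U)"
    by (simp add: pentagon)
  also have "\<dots> = (Idt C X \<otimes> RUnit C Y \<otimes> Idt C ?U) \<cdot>
      Assoc C X (Y \<odot> ?U) ?U \<cdot> (Assoc C X Y ?U \<otimes> Idt C ?U)"
    by (simp add: triangle)
  also have "\<dots> = Assoc C X Y ?U \<cdot> (((Idt C X \<otimes> RUnit C Y) \<cdot> Assoc C X Y ?U) \<otimes> Idt C ?U)"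
    using Comp_eq_assoc[OF Assoc_nat_arr[of "Idt C X" "RUnit C Y" "Idt C ?U" X Y ?U],
        of "Assoc C X Y ?U \<otimes> Idt C ?U"] by simp
  finally have "RUnit C (X \<odot> Y) \<otimes> Idt C ?U = ((Idt C X \<otimes> RUnit C Y) \<cdot> Assoc C X Y ?U) \<otimes> Idt C ?U"
    by (rule iso_monic[rotated 5]) (simp_all add: Assoc_iso)
  then show ?thesis by (rule Tens_Unit_inject[rotated 4, symmetric]) simp_all
qed

lemma LUnit_TensOb:
  assumes X: "X \<in> Ob C" and Y: "Y \<in> Ob C"
  shows "LUnit C (X \<odot> Y) \<cdot> Assoc C (Unit C) X Y = LUnit C X \<otimes> Idt C Y"
proof -
  let ?U = "Unit C"
  note [simp] = X Y
  \<comment> \<open>The last two factors on the long side of the pentagon at \<open>?U\<close>,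
    \<open>?U\<close>, \<open>X\<close>, \<open>Y\<close>. Both are invertible and are cancelled one
    after the other at the end.\<close>
  let ?k = "Assoc C ?U (?U \<odot> X) Y \<cdot> (Assoc C ?U ?U X \<otimes> Idt C Y)"
  have "(Idt C ?U \<otimes> (LUnit C (X \<odot> Y) \<cdot> Assoc C ?U X Y)) \<cdot> ?k =
      (Idt C ?U \<otimes> LUnit C (X \<odot> Y)) \<cdot> Assoc C ?U ?U (X \<odot> Y) \<cdot> Assoc C (?U \<odot> ?U) X Y"
    by (simp add: pentagon)
  also have "\<dots> = (RUnit C ?U \<otimes> Idt C (X \<odot> Y)) \<cdot> Assoc C (?U \<odot> ?U) X Y"
    using Comp_eq_assoc[OF triangle[of ?U "X \<odot> Y"]] by simp
  also have "\<dots> = Assoc C ?U X Y \<cdot> ((RUnit C ?U \<otimes> Idt C X) \<otimes> Idt C Y)"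
    using Assoc_nat_arr[of "RUnit C ?U" "Idt C X" "Idt C Y" ?U X Y] by simp
  also have "\<dots> = Assoc C ?U X Y \<cdot> ((Idt C ?U \<otimes> LUnit C X) \<otimes> Idt C Y) \<cdot> (Assoc C ?U ?U X \<otimes> Idt C Y)"
    by (simp add: triangle)
  also have "\<dots> = (Idt C ?U \<otimes> LUnit C X \<otimes> Idt C Y) \<cdot> ?k"
    using Comp_eq_assoc[OF Assoc_nat_arr[of "Idt C ?U" "LUnit C X" "Idt C Y" ?U X Y],
        of "Assoc C ?U ?U X \<otimes> Idt C Y"] by simp
  finally have "((Idt C ?U \<otimes> (LUnit C (X \<odot> Y) \<cdot> Assoc C ?U X Y)) \<cdot> Assoc C ?U (?U \<odot> X) Y) \<cdot>
      (Assoc C ?U ?U X \<otimes> Idt C Y) =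
      ((Idt C ?U \<otimes> LUnit C X \<otimes> Idt C Y) \<cdot> Assoc C ?U (?U \<odot> X) Y) \<cdot> (Assoc C ?U ?U X \<otimes> Idt C Y)"
    by simp
  then have "(Idt C ?U \<otimes> (LUnit C (X \<odot> Y) \<cdot> Assoc C ?U X Y)) \<cdot> Assoc C ?U (?U \<odot> X) Y =
      (Idt C ?U \<otimes> LUnit C X \<otimes> Idt C Y) \<cdot> Assoc C ?U (?U \<odot> X) Y"
    by (rule iso_epic[rotated 5]) (simp_all add: iso_Tens Assoc_iso iso_Idt)
  then have "Idt C ?U \<otimes> (LUnit C (X \<odot> Y) \<cdot> Assoc C ?U X Y) = Idt C ?U \<otimes> LUnit C X \<otimes> Idt C Y"
    by (rule iso_epic[rotated 5]) (simp_all add: Assoc_iso)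
  then show ?thesis by (rule Unit_Tens_inject[rotated 4]) simp_all
qed

text \<open>Take the hexagon with two unit objects and follow it by a left unitor. The triangle,
  \<open>LUnit_TensOb\<close> and naturality reduce it to the claim tensored with the unit object
  and followed by a symmetry; the symmetry is invertible and the unit factor cancels.\<close>

lemma LUnit_Sym:
  assumes X: "X \<in> Ob C"
  shows "LUnit C X \<cdot> Sym C X (Unit C) = RUnit C X"
proof -
  let ?U = "Unit C"
  note [simp] = X
  have "Sym C X ?U \<cdot> (RUnit C X \<otimes> Idt C ?U) =
      Sym C X ?U \<cdot> (Idt C X \<otimes> LUnit C ?U) \<cdot> Assoc C X ?U ?U"
    by (simp add: triangle)
  also have "\<dots> = (LUnit C ?U \<otimes> Idt C X) \<cdot> Sym C X (?U \<odot> ?U) \<cdot> Assoc C X ?U ?U"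
    using Comp_eq_assoc[OF Sym_nat_arr[of "Idt C X" "LUnit C ?U" X ?U]] by simp
  also have "\<dots> = LUnit C (?U \<odot> X) \<cdot> Assoc C ?U ?U X \<cdot> Sym C X (?U \<odot> ?U) \<cdot> Assoc C X ?U ?U"
    by (simp flip: LUnit_TensOb)
  also have "\<dots> = LUnit C (?U \<odot> X) \<cdot> (Idt C ?U \<otimes> Sym C X ?U) \<cdot> Assoc C ?U X ?U \<cdot> (Sym C X ?U \<otimes> Idt C ?U)"
    by (simp add: hexagon)
  also have "\<dots> = Sym C X ?U \<cdot> LUnit C (X \<odot> ?U) \<cdot> Assoc C ?U X ?U \<cdot> (Sym C X ?U \<otimes> Idt C ?U)"
    using Comp_eq_assoc[OF LUnit_nat[of "Sym C X ?U" "X \<odot> ?U" "?U \<odot> X"]] by (simp add: Hom_def)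
  also have "\<dots> = Sym C X ?U \<cdot> ((LUnit C X \<cdot> Sym C X ?U) \<otimes> Idt C ?U)"
    using Comp_eq_assoc[OF LUnit_TensOb[of X ?U], of "Sym C X ?U \<otimes> Idt C ?U"] by simp
  finally have "RUnit C X \<otimes> Idt C ?U = (LUnit C X \<cdot> Sym C X ?U) \<otimes> Idt C ?U"
    by (rule iso_monic[rotated 5]) (simp_all add: iso_Sym)
  then show ?thesis by (rule Tens_Unit_inject[rotated 4, symmetric]) simp_all
qed

section \<open>Interchange of the last two factors\<close>

definition swap :: "'o \<Rightarrow> 'o \<Rightarrow> 'o \<Rightarrow> 'm" where
  "swap X Y Z = inverse_of C (Assoc C X Z Y) \<cdot> (Idt C X \<otimes> Sym C Y Z) \<cdot> Assoc C X Y Z"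

lemma swap_arr [simp]:
  assumes "X \<in> Ob C" "Y \<in> Ob C" "Z \<in> Ob C"
  shows "swap X Y Z \<in> Arr C" "Dom C (swap X Y Z) = (X \<odot> Y) \<odot> Z" "Cod C (swap X Y Z) = (X \<odot> Z) \<odot> Y"
  using assms by (simp_all add: swap_def)

text \<open>Associators are monic, so equations about \<open>swap\<close> can be checked after
  composing with one; this removes the inverse associator from the definition.\<close>

lemma Assoc_swap:
  assumes "X \<in> Ob C" "Y \<in> Ob C" "Z \<in> Ob C"
  shows "Assoc C X Z Y \<cdot> swap X Y Z = (Idt C X \<otimes> Sym C Y Z) \<cdot> Assoc C X Y Z"
  using assms by (simp add: swap_def inverse_of_cancel Assoc_iso)

lemma swap_swap:
  assumes [simp]: "X \<in> Ob C" "Y \<in> Ob C" "Z \<in> Ob C"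
  shows "swap X Z Y \<cdot> swap X Y Z = Idt C ((X \<odot> Y) \<odot> Z)"
proof (rule iso_monic[OF Assoc_iso[of X Y Z]])
  have "Assoc C X Y Z \<cdot> swap X Z Y \<cdot> swap X Y Z = (Idt C X \<otimes> Sym C Z Y) \<cdot> Assoc C X Z Y \<cdot> swap X Y Z"
    using Comp_eq_assoc[OF Assoc_swap[of X Z Y], of "swap X Y Z"] by simp
  then show "Assoc C X Y Z \<cdot> swap X Z Y \<cdot> swap X Y Z = Assoc C X Y Z \<cdot> Idt C ((X \<odot> Y) \<odot> Z)"
    by (simp add: Assoc_swap Sym_Sym)
qed simp_all

lemma swap_nat:
  assumes [simp]: "f \<in> Arr C" "g \<in> Arr C" "h \<in> Arr C"
    and [simp]: "Cod C f = X" "Cod C g = Y" "Cod C h = Z"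
  shows "swap X Y Z \<cdot> ((f \<otimes> g) \<otimes> h) = ((f \<otimes> h) \<otimes> g) \<cdot> swap (Dom C f) (Dom C g) (Dom C h)"
proof -
  have [simp]: "X \<in> Ob C" "Y \<in> Ob C" "Z \<in> Ob C" using assms Cod_Ob by blast+
  show ?thesis
  proof (rule iso_monic[OF Assoc_iso[of X Z Y]])
    have "Assoc C X Z Y \<cdot> swap X Y Z \<cdot> ((f \<otimes> g) \<otimes> h) =
        (Idt C X \<otimes> Sym C Y Z) \<cdot> Assoc C X Y Z \<cdot> ((f \<otimes> g) \<otimes> h)"
      using Comp_eq_assoc[OF Assoc_swap[of X Y Z], of "(f \<otimes> g) \<otimes> h"] by simp
    also have "\<dots> = (f \<otimes> h \<otimes> g) \<cdot> (Idt C (Dom C f) \<otimes> Sym C (Dom C g) (Dom C h)) \<cdot>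
        Assoc C (Dom C f) (Dom C g) (Dom C h)"
      by (simp add: Assoc_nat_arr Sym_nat_arr)
    also have "\<dots> = (f \<otimes> h \<otimes> g) \<cdot> Assoc C (Dom C f) (Dom C h) (Dom C g) \<cdot>
        swap (Dom C f) (Dom C g) (Dom C h)"
      by (simp add: Assoc_swap)
    also have "\<dots> = Assoc C X Z Y \<cdot> ((f \<otimes> h) \<otimes> g) \<cdot> swap (Dom C f) (Dom C g) (Dom C h)"
      using Comp_eq_assoc[OF Assoc_nat_arr[of f h g X Z Y],
          of "swap (Dom C f) (Dom C g) (Dom C h)"] by simp
    finally show "Assoc C X Z Y \<cdot> swap X Y Z \<cdot> ((f \<otimes> g) \<otimes> h) =
        Assoc C X Z Y \<cdot> ((f \<otimes> h) \<otimes> g) \<cdot> swap (Dom C f) (Dom C g) (Dom C h)" .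
  qed simp_all
qed

text \<open>The triangle exposes an associator that cancels the inverse one in \<open>swap\<close>.
  The symmetry that remains turns a left unitor into a right one by
  \<open>LUnit_Sym\<close>.\<close>

lemma RUnit_swap:
  assumes [simp]: "X \<in> Ob C" "Y \<in> Ob C"
  shows "(RUnit C X \<otimes> Idt C Y) \<cdot> swap X Y (Unit C) = RUnit C (X \<odot> Y)"
proof -
  let ?U = "Unit C"
  have "(RUnit C X \<otimes> Idt C Y) \<cdot> swap X Y ?U =
      (Idt C X \<otimes> LUnit C Y) \<cdot> Assoc C X ?U Y \<cdot> swap X Y ?U"
    using Comp_eq_assoc[OF triangle[of X Y], of "swap X Y ?U"] by simp
  also have "\<dots> = (Idt C X \<otimes> RUnit C Y) \<cdot> Assoc C X Y ?U"
    by (simp add: Assoc_swap LUnit_Sym)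
  finally show ?thesis by (simp add: RUnit_TensOb)
qed

section \<open>Adjoining a point of an object\<close>

definition pt :: "'m \<Rightarrow> 'o \<Rightarrow> 'm" where
  "pt p X = (Idt C X \<otimes> p) \<cdot> inverse_of C (RUnit C X)"

lemma pt_arr [simp]:
  assumes "p \<in> Hom C (Unit C) D" "X \<in> Ob C"
  shows "pt p X \<in> Arr C" "Dom C (pt p X) = X" "Cod C (pt p X) = X \<odot> D"
  using assms by (simp_all add: pt_def Hom_def)

text \<open>Right unitors are epic, so identities about \<open>pt\<close> are tested after
  precomposing with one; this equation then eliminates the inverse unitor.\<close>

lemma pt_RUnit:
  assumes "p \<in> Hom C (Unit C) D" "X \<in> Ob C"
  shows "pt p X \<cdot> RUnit C X = Idt C X \<otimes> p"
  using assms inverse_of_arr(5)[OF RUnit_iso[of X]] by (simp add: pt_def Hom_def)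

lemma pt_nat:
  assumes p: "p \<in> Hom C (Unit C) D" and [simp]: "f \<in> Arr C" "Cod C f = Y"
  shows "(f \<otimes> Idt C D) \<cdot> pt p (Dom C f) = pt p Y \<cdot> f"
proof -
  let ?X = "Dom C f"
  have [simp]: "p \<in> Arr C" "Dom C p = Unit C" "Cod C p = D" "D \<in> Ob C" "Y \<in> Ob C"
    using p Cod_Ob[of p] Cod_Ob[of f] assms(2,3) by (auto simp: Hom_def)
  show ?thesis
  proof (rule iso_epic[OF RUnit_iso[of ?X]])
    \<comment> \<open>Precomposed with the unitor, both sides become
      \<open>f \<otimes> p\<close>.\<close>
    have "(pt p Y \<cdot> f) \<cdot> RUnit C ?X = pt p Y \<cdot> RUnit C Y \<cdot> (f \<otimes> Idt C (Unit C))"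
      using p RUnit_nat[of f ?X Y] by (simp add: Hom_def)
    also have "\<dots> = f \<otimes> p"
      using Comp_eq_assoc[OF pt_RUnit[OF p, of Y], of "f \<otimes> Idt C (Unit C)"] p by simp
    finally show "((f \<otimes> Idt C D) \<cdot> pt p ?X) \<cdot> RUnit C ?X = (pt p Y \<cdot> f) \<cdot> RUnit C ?X"
      using p by (simp add: pt_RUnit)
  qed (use p in simp_all)
qed

text \<open>After precomposition with the right unitor, naturality of the associator in its third
  argument moves \<open>p\<close> beside \<open>Y\<close>, and \<open>RUnit_TensOb\<close> restores
  the unitor.\<close>

lemma Assoc_pt:
  assumes p: "p \<in> Hom C (Unit C) D" and [simp]: "X \<in> Ob C" "Y \<in> Ob C"
  shows "Assoc C X Y D \<cdot> pt p (X \<odot> Y) = Idt C X \<otimes> pt p Y"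
proof (rule iso_epic[OF RUnit_iso[of "X \<odot> Y"]])
  have [simp]: "p \<in> Arr C" "Dom C p = Unit C" "Cod C p = D" "D \<in> Ob C"
    using p Cod_Ob by (auto simp: Hom_def)
  have "(Assoc C X Y D \<cdot> pt p (X \<odot> Y)) \<cdot> RUnit C (X \<odot> Y) = (Idt C X \<otimes> Idt C Y \<otimes> p) \<cdot> Assoc C X Y (Unit C)"
    using p Assoc_nat_arr[of "Idt C X" "Idt C Y" p X Y D] by (simp add: pt_RUnit)
  also have "\<dots> = (Idt C X \<otimes> (pt p Y \<cdot> RUnit C Y)) \<cdot> Assoc C X Y (Unit C)"
    using p by (simp add: pt_RUnit)
  also have "\<dots> = (Idt C X \<otimes> pt p Y) \<cdot> (Idt C X \<otimes> RUnit C Y) \<cdot> Assoc C X Y (Unit C)"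
    using p by simp
  also have "\<dots> = (Idt C X \<otimes> pt p Y) \<cdot> RUnit C (X \<odot> Y)"
    using p by (simp only: RUnit_TensOb assms)
  finally show "(Assoc C X Y D \<cdot> pt p (X \<odot> Y)) \<cdot> RUnit C (X \<odot> Y) = (Idt C X \<otimes> pt p Y) \<cdot> RUnit C (X \<odot> Y)" .
qed (use p in \<open>auto simp: Hom_def\<close>)

text \<open>The argument of \<open>Assoc_pt\<close>, with \<open>swap_nat\<close> and
  \<open>RUnit_swap\<close> in place of the laws of the associator.\<close>

lemma swap_pt:
  assumes p: "p \<in> Hom C (Unit C) D" and [simp]: "X \<in> Ob C" "Y \<in> Ob C"
  shows "swap X Y D \<cdot> pt p (X \<odot> Y) = pt p X \<otimes> Idt C Y"
proof (rule iso_epic[OF RUnit_iso[of "X \<odot> Y"]])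
  have [simp]: "p \<in> Arr C" "Dom C p = Unit C" "Cod C p = D" "D \<in> Ob C"
    using p Cod_Ob by (auto simp: Hom_def)
  have "(swap X Y D \<cdot> pt p (X \<odot> Y)) \<cdot> RUnit C (X \<odot> Y) = ((Idt C X \<otimes> p) \<otimes> Idt C Y) \<cdot> swap X Y (Unit C)"
    using p swap_nat[of "Idt C X" "Idt C Y" p X Y D] by (simp add: pt_RUnit)
  also have "\<dots> = ((pt p X \<cdot> RUnit C X) \<otimes> Idt C Y) \<cdot> swap X Y (Unit C)"
    using p by (simp add: pt_RUnit)
  also have "\<dots> = (pt p X \<otimes> Idt C Y) \<cdot> (RUnit C X \<otimes> Idt C Y) \<cdot> swap X Y (Unit C)"
    using p by simp
  also have "\<dots> = (pt p X \<otimes> Idt C Y) \<cdot> RUnit C (X \<odot> Y)"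
    using p by (simp only: RUnit_swap assms)
  finally show "(swap X Y D \<cdot> pt p (X \<odot> Y)) \<cdot> RUnit C (X \<odot> Y) = (pt p X \<otimes> Idt C Y) \<cdot> RUnit C (X \<odot> Y)" .
qed (use p in \<open>auto simp: Hom_def\<close>)

text \<open>The form needed for currying, where a witness on \<open>(X \<odot> Y) \<odot> D\<close>
  must have \<open>Y\<close> as its last factor before it can be transposed.\<close>

lemma swap_pt':
  assumes p: "p \<in> Hom C (Unit C) D" and [simp]: "X \<in> Ob C" "Y \<in> Ob C"
  shows "swap X D Y \<cdot> (pt p X \<otimes> Idt C Y) = pt p (X \<odot> Y)"
proof -
  have [simp]: "D \<in> Ob C" using p Cod_Ob by (auto simp: Hom_def)
  show ?thesis
    using Comp_eq_assoc[OF swap_swap[of X Y D], of "pt p (X \<odot> Y)"] p by (simp add: swap_pt)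
qed

end


section \<open>Transposition\<close>

context symmetric_monoidal_closed_category
begin

declare IHom_Ob [simp]

lemma Ev_arr [simp]:
  assumes "Y \<in> Ob C" "Z \<in> Ob C"
  shows "Ev C Y Z \<in> Arr C" "Dom C (Ev C Y Z) = (Y \<leadsto> Z) \<odot> Y" "Cod C (Ev C Y Z) = Z"
  using Ev_Hom[OF assms] by (auto simp: Hom_def)

lemma cur_props:
  assumes "X \<in> Ob C" "Y \<in> Ob C" "f \<in> Hom C (X \<odot> Y) Z"
  shows "cur C X Y f \<in> Hom C X (Y \<leadsto> Z) \<and> Ev C Y Z \<cdot> (cur C X Y f \<otimes> Idt C Y) = f"
proof -
  have Z: "Z \<in> Ob C" "Cod C f = Z" using assms(3) Cod_Ob by (auto simp: Hom_def)
  from theI'[OF cur_ex1[OF assms(1,2) Z(1) assms(3)]] show ?thesis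
    unfolding cur_def by (simp add: Z)
qed

lemma cur_arr [simp]:
  assumes "X \<in> Ob C" "Y \<in> Ob C" "f \<in> Arr C" "Dom C f = X \<odot> Y"
  shows "cur C X Y f \<in> Arr C" "Dom C (cur C X Y f) = X" "Cod C (cur C X Y f) = Y \<leadsto> Cod C f"
  using cur_props[OF assms(1,2), of f "Cod C f"] assms by (auto simp: Hom_def)

lemma Ev_cur:
  assumes "X \<in> Ob C" "Y \<in> Ob C" "f \<in> Arr C" "Dom C f = X \<odot> Y" "Cod C f = Z"
  shows "Ev C Y Z \<cdot> (cur C X Y f \<otimes> Idt C Y) = f"
  using cur_props[OF assms(1,2), of f Z] assms by (auto simp: Hom_def)

lemma cur_Ev:
  assumes "h \<in> Arr C" "Dom C h = X" "Cod C h = Y \<leadsto> Z" "Y \<in> Ob C" "Z \<in> Ob C"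
  shows "cur C X Y (Ev C Y Z \<cdot> (h \<otimes> Idt C Y)) = h"
proof -
  let ?f = "Ev C Y Z \<cdot> (h \<otimes> Idt C Y)"
  have X: "X \<in> Ob C" using assms Dom_Ob by blast
  have f: "?f \<in> Hom C (X \<odot> Y) Z" using assms by (simp add: Hom_def)
  show ?thesis
    using cur_ex1[OF X assms(4,5) f] cur_props[OF X assms(4) f] assms by (auto simp: Hom_def)
qed

text \<open>Both sides have the same image under evaluation, so uniqueness of the transpose
  identifies them.\<close>

lemma cur_Comp:
  assumes "f \<in> Arr C" "Dom C f = X \<odot> Y" "k \<in> Arr C" "Cod C k = X" "Y \<in> Ob C"
  shows "cur C X Y f \<cdot> k = cur C (Dom C k) Y (f \<cdot> (k \<otimes> Idt C Y))"
proof -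
  have [simp]: "X \<in> Ob C" using assms Cod_Ob by blast
  have "f \<cdot> (k \<otimes> Idt C Y) = Ev C Y (Cod C f) \<cdot> (cur C X Y f \<otimes> Idt C Y) \<cdot> (k \<otimes> Idt C Y)"
    using Comp_eq_assoc[OF Ev_cur[of X Y f "Cod C f"], of "k \<otimes> Idt C Y"] assms by simp
  also have "\<dots> = Ev C Y (Cod C f) \<cdot> ((cur C X Y f \<cdot> k) \<otimes> Idt C Y)" using assms by simp
  finally show ?thesis using assms by (simp add: cur_Ev)
qed

lemma ev_at_pt:
  assumes "p \<in> Hom C (Unit C) D" "X \<in> Ob C"
  shows "ev_at C D p X = Ev C D X \<cdot> pt p (D \<leadsto> X)"
  by (simp add: ev_at_def pt_def)

text \<open>Naturality of \<open>pt\<close> lets \<open>h\<close> act before the point is inserted.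
  With \<open>ev_at_cur\<close> this translates between witnesses in \<open>D \<leadsto> X\<close>
  and their uncurried forms.\<close>

lemma ev_at_Comp:
  assumes p: "p \<in> Hom C (Unit C) D" and [simp]: "X \<in> Ob C" "h \<in> Arr C" "Cod C h = D \<leadsto> X"
  shows "ev_at C D p X \<cdot> h = (Ev C D X \<cdot> (h \<otimes> Idt C D)) \<cdot> pt p (Dom C h)"
proof -
  have [simp]: "D \<in> Ob C" using p Cod_Ob by (auto simp: Hom_def)
  show ?thesis using p by (simp add: ev_at_pt pt_nat)
qed

lemma ev_at_cur:
  assumes p: "p \<in> Hom C (Unit C) D" and "W \<in> Ob C" "u \<in> Arr C" "Dom C u = W \<odot> D" "Cod C u = X"
  shows "ev_at C D p X \<cdot> cur C W D u = u \<cdot> pt p W"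
proof -
  have [simp]: "D \<in> Ob C" "X \<in> Ob C" using p assms Cod_Ob by (auto simp: Hom_def)
  show ?thesis using assms by (simp add: ev_at_Comp Ev_cur del: Comp_assoc_arr)
qed

end


section \<open>Summable families\<close>

context representable_smcc
begin

declare D_Ob [simp]

lemma point_arr [simp]:
  "\<iota> i \<in> Hom C (Unit C) D" "\<Delta> \<in> Hom C (Unit C) D"
  by (rule inj_Hom Delta_Hom)+

lemma csum_Hom:
  assumes "csum (PS X Y) A f = Some s" "countable A" "X \<in> Ob C" "Y \<in> Ob C"
  shows "s \<in> Hom C X Y" "a \<in> A \<Longrightarrow> f a \<in> Hom C X Y"
  using pcm.csum_mem[OF PS_pcm[OF assms(3,4)] assms(1,2)] by auto

lemma pt_point_arr [simp]:
  assumes "X \<in> Ob C"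
  shows "pt (\<iota> i) X \<in> Arr C" "Dom C (pt (\<iota> i) X) = X" "Cod C (pt (\<iota> i) X) = X \<odot> D"
    "pt \<Delta> X \<in> Arr C" "Dom C (pt \<Delta> X) = X" "Cod C (pt \<Delta> X) = X \<odot> D"
  using assms by (simp_all add: pt_arr[OF point_arr(1)] pt_arr[OF point_arr(2)])

text \<open>The axioms of a summability structure for \<open>n = 1\<close>, with the witness
  \<open>X \<rightarrow> (D \<leadsto> Y)\<close> replaced by its uncurried form
  \<open>u\<close>.\<close>

lemma csum_UNIV_iff:
  assumes [simp]: "X \<in> Ob C" "Y \<in> Ob C" and F: "\<And>n. F n \<in> Hom C X Y"
  shows "csum (PS X Y) (UNIV :: nat set) F = Some s \<longleftrightarrow>
    (\<exists>u \<in> Hom C (X \<odot> D) Y. (\<forall>n. u \<cdot> pt (\<iota> n) X = F n) \<and> s = u \<cdot> pt \<Delta> X)"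
proof -
  interpret P: pcm "Hom C X Y" "PS X Y" by (rule PS_pcm) simp_all
  \<comment> \<open>The axioms speak of families indexed by tuples, so a number is coded as a list
    of length one.\<close>
  let ?L = "{is :: nat list. length is = 1}" and ?F = "\<lambda>is. F (hd is)"
  have "bij_betw (\<lambda>n. [n]) UNIV ?L"
    by (rule bij_betw_byWitness[where f' = hd]) (auto simp: length_Suc_conv)
  from P.csum_reindex[OF this, of ?F]
  have red: "csum (PS X Y) UNIV F = csum (PS X Y) ?L ?F" by (simp add: o_def)
  have proj: "iter_proj C (IHom C D) (\<lambda>i. ev_at C D (\<iota> i)) is Y \<cdot> h = ev_at C D (\<iota> (hd is)) Y \<cdot> h"
    if "length is = 1" "h \<in> Hom C X (D \<leadsto> Y)" for "is" h
    using that proj_Hom[of Y "hd is"] by (auto simp: length_Suc_conv Hom_def)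
  have sum1: "iter_sum C (IHom C D) (ev_at C D \<Delta>) 1 Y \<cdot> h = ev_at C D \<Delta> Y \<cdot> h" for h
    using sum_Hom[of Y] by (simp add: Hom_def)
  have FL: "?F is \<in> Hom C X Y" for "is" by (rule F)
  have sum: "csum (PS X Y) ?L ?F = Some (ev_at C D \<Delta> Y \<cdot> h)"
    if h: "h \<in> Hom C X (D \<leadsto> Y)" "\<And>n. ev_at C D (\<iota> n) Y \<cdot> h = F n" for h
    using PS_sum[of X Y 1 ?F h] h FL proj sum1 by auto
  show ?thesis
  proof
    assume s: "csum (PS X Y) UNIV F = Some s"
    then have "csum (PS X Y) ?L ?F \<noteq> None" using red by simp
    then obtain h where h: "h \<in> Hom C X (D \<leadsto> Y)"
      "\<forall>is. length is = 1 \<longrightarrow> iter_proj C (IHom C D) (\<lambda>i. ev_at C D (\<iota> i)) is Y \<cdot> h = ?F is"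
      using PS_summable_iff[of X Y 1 ?F] FL by auto
    have hF: "ev_at C D (\<iota> n) Y \<cdot> h = F n" for n
      using h(2)[rule_format, of "[n]"] proj[of "[n]" h] h(1) by simp
    have seq: "s = ev_at C D \<Delta> Y \<cdot> h" using sum[OF h(1) hF] s red by simp
    let ?u = "Ev C D Y \<cdot> (h \<otimes> Idt C D)"
    have "ev_at C D p Y \<cdot> h = ?u \<cdot> pt p X" if "p \<in> Hom C (Unit C) D" for p
      using ev_at_Comp[OF that, of Y h] h(1) by (simp add: Hom_def del: Comp_assoc_arr)
    moreover have "?u \<in> Hom C (X \<odot> D) Y" using h(1) by (simp add: Hom_def)
    ultimately show "\<exists>u \<in> Hom C (X \<odot> D) Y. (\<forall>n. u \<cdot> pt (\<iota> n) X = F n) \<and> s = u \<cdot> pt \<Delta> X"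
      using hF seq by (intro bexI[of _ ?u]) simp_all
  next
    assume "\<exists>u \<in> Hom C (X \<odot> D) Y. (\<forall>n. u \<cdot> pt (\<iota> n) X = F n) \<and> s = u \<cdot> pt \<Delta> X"
    then obtain u where u: "u \<in> Hom C (X \<odot> D) Y" "\<And>n. u \<cdot> pt (\<iota> n) X = F n" "s = u \<cdot> pt \<Delta> X"
      by blast
    have "ev_at C D p Y \<cdot> cur C X D u = u \<cdot> pt p X" if "p \<in> Hom C (Unit C) D" for p
      using ev_at_cur[OF that, of X u Y] u(1) by (simp add: Hom_def)
    then show "csum (PS X Y) UNIV F = Some s"
      using sum[of "cur C X D u"] u red cur_props[of X D u Y] by simp
  qed
qed

text \<open>Mind the order: in the list \<open>[j, i]\<close> the last entry is evaluated first, hence belongs to the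
  copy of \<open>D\<close> next to \<open>X\<close>.\<close>

lemma csum_UNIV2:
  assumes [simp]: "X \<in> Ob C" "Y \<in> Ob C" and u: "u \<in> Hom C ((X \<odot> D) \<odot> D) Y"
    and F: "\<And>i j. u \<cdot> pt (\<iota> j) (X \<odot> D) \<cdot> pt (\<iota> i) X = F (i, j)"
  shows "csum (PS X Y) UNIV F = Some (u \<cdot> pt \<Delta> (X \<odot> D) \<cdot> pt \<Delta> X)"
proof -
  interpret P: pcm "Hom C X Y" "PS X Y" by (rule PS_pcm) simp_all
  let ?L = "{is :: nat list. length is = 2}" and ?F = "\<lambda>is. F (is ! 1, is ! 0)"
  \<comment> \<open>The inner transpose abstracts the last copy of \<open>D\<close>, the outer one
    the copy next to \<open>X\<close>; thus \<open>?h\<close> ends in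
    \<open>D \<leadsto> (D \<leadsto> Y)\<close>, as the axioms for \<open>n = 2\<close>
    require.\<close>
  let ?h = "cur C X D (cur C (X \<odot> D) D u)"
  have "bij_betw (\<lambda>(i, j). [j, i]) UNIV ?L"
    by (rule bij_betw_byWitness[where f' = "\<lambda>is. (is ! 1, is ! 0)"])
      (auto simp: length_Suc_conv numeral_2_eq_2)
  from P.csum_reindex[OF this, of ?F]
  have red: "csum (PS X Y) UNIV F = csum (PS X Y) ?L ?F" by (simp add: o_def case_prod_beta)
  have u' [simp]: "u \<in> Arr C" "Dom C u = (X \<odot> D) \<odot> D" "Cod C u = Y"
    using u by (auto simp: Hom_def)
  have ev: "ev_at C D q Y \<in> Arr C" "Dom C (ev_at C D q Y) = D \<leadsto> Y" "Cod C (ev_at C D q Y) = Y"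
    if "q \<in> Hom C (Unit C) D" "Y \<in> Ob C" for q Y
    using that by (simp_all add: ev_at_pt)
  \<comment> \<open>Stated for two arbitrary points, this serves the projections and the sum
    alike.\<close>
  have step: "ev_at C D q Y \<cdot> ev_at C D p (D \<leadsto> Y) \<cdot> ?h = u \<cdot> pt q (X \<odot> D) \<cdot> pt p X"
    if p: "p \<in> Hom C (Unit C) D" and q: "q \<in> Hom C (Unit C) D" for p q
  proof -
    have "ev_at C D p (D \<leadsto> Y) \<cdot> ?h = cur C (X \<odot> D) D u \<cdot> pt p X"
      using p by (simp add: ev_at_cur)
    then show ?thesis
      using Comp_eq_assoc[OF ev_at_cur[OF q, of "X \<odot> D" u Y], of "pt p X"] p q by (simp add: ev)
  qed
  have FH: "F (i, j) \<in> Hom C X Y" for i j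
    unfolding F[symmetric] by (simp add: Hom_def)
  have "csum (PS X Y) ?L ?F = Some (iter_sum C (IHom C D) (ev_at C D \<Delta>) 2 Y \<cdot> ?h)"
  proof (rule PS_sum)
    show "iter_proj C (IHom C D) (\<lambda>i. ev_at C D (\<iota> i)) is Y \<cdot> ?h = ?F is" if "length is = 2" for "is"
      using that by (auto simp: length_Suc_conv numeral_2_eq_2 ev step F)
  qed (use FH in \<open>simp_all add: Hom_def numeral_2_eq_2\<close>)
  also have "iter_sum C (IHom C D) (ev_at C D \<Delta>) 2 Y \<cdot> ?h = u \<cdot> pt \<Delta> (X \<odot> D) \<cdot> pt \<Delta> X"
    by (simp add: numeral_2_eq_2 ev step)
  finally show ?thesis using red by simp
qed

section \<open>Families over countable sets as sequences padded by zero\<close>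

definition seq :: "'o \<Rightarrow> 'o \<Rightarrow> 'a set \<Rightarrow> ('a \<Rightarrow> 'm) \<Rightarrow> nat \<Rightarrow> 'm" where
  "seq X Y A f n = (if n \<in> to_nat_on A ` A then f (from_nat_into A n) else Zero C X Y)"

lemma seq_to_nat_on: "\<lbrakk>countable A; a \<in> A\<rbrakk> \<Longrightarrow> seq X Y A f (to_nat_on A a) = f a"
  by (simp add: seq_def)

lemma seq_Hom:
  assumes "countable A" "\<And>a. a \<in> A \<Longrightarrow> f a \<in> Hom C X Y" "X \<in> Ob C" "Y \<in> Ob C"
  shows "seq X Y A f n \<in> Hom C X Y"
  using assms Zero_Hom by (auto simp: seq_def)

text \<open>The zero morphism is the empty sum by \<open>PS_empty\<close>, so
  \<open>csum_extend\<close> discards the padding; the rest is reindexing along the enumeration of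
  \<open>A\<close>.\<close>

lemma csum_seq:
  assumes "countable A" "X \<in> Ob C" "Y \<in> Ob C"
  shows "csum (PS X Y) UNIV (seq X Y A f) = csum (PS X Y) A f"
proof -
  interpret P: pcm "Hom C X Y" "PS X Y" by (rule PS_pcm) fact+
  have "csum (PS X Y) UNIV (seq X Y A f) = csum (PS X Y) (to_nat_on A ` A) (seq X Y A f)"
    by (rule P.csum_extend) (use PS_empty assms in \<open>auto simp: seq_def\<close>)
  also have "\<dots> = csum (PS X Y) A (seq X Y A f \<circ> to_nat_on A)"
    by (rule P.csum_reindex[symmetric]) (use assms in \<open>auto intro: inj_on_imp_bij_betw\<close>)
  also have "\<dots> = csum (PS X Y) A f"
    by (rule P.csum_cong) (use assms in \<open>simp_all add: seq_to_nat_on\<close>)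
  finally show ?thesis .
qed

lemma csum_iff:
  assumes "countable A" "X \<in> Ob C" "Y \<in> Ob C" "\<And>a. a \<in> A \<Longrightarrow> f a \<in> Hom C X Y"
  shows "csum (PS X Y) A f = Some s \<longleftrightarrow>
    (\<exists>u \<in> Hom C (X \<odot> D) Y. (\<forall>n. u \<cdot> pt (\<iota> n) X = seq X Y A f n) \<and> s = u \<cdot> pt \<Delta> X)"
  using csum_UNIV_iff[of X Y "seq X Y A f" s] csum_seq[of A X Y f] seq_Hom[of A f X Y] assms by simp

text \<open>\<open>L\<close> turns a witness for \<open>f\<close> into one for its image under
  \<open>\<Phi>\<close>: the second lifting hypothesis gives the members at the points
  \<open>\<iota> n\<close> and the sum at \<open>\<Delta>\<close>. Since \<open>\<Phi>\<close>
  preserves zero, padding goes to padding.\<close>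

lemma csum_lift:
  assumes s: "csum (PS X Y) A f = Some s" and A: "countable A"
    and Ob: "X \<in> Ob C" "Y \<in> Ob C" "X' \<in> Ob C" "Y' \<in> Ob C"
    and zero: "\<Phi> (Zero C X Y) = Zero C X' Y'"
    and Hom: "\<And>f. f \<in> Hom C X Y \<Longrightarrow> \<Phi> f \<in> Hom C X' Y'"
    and lift: "\<And>u. u \<in> Hom C (X \<odot> D) Y \<Longrightarrow> L u \<in> Hom C (X' \<odot> D) Y'"
      "\<And>u p. \<lbrakk>u \<in> Hom C (X \<odot> D) Y; p \<in> Hom C (Unit C) D\<rbrakk> \<Longrightarrow> L u \<cdot> pt p X' = \<Phi> (u \<cdot> pt p X)"
  shows "csum (PS X' Y') A (\<lambda>a. \<Phi> (f a)) = Some (\<Phi> s)"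
proof -
  note f = csum_Hom(2)[OF s A Ob(1,2)]
  obtain u where u: "u \<in> Hom C (X \<odot> D) Y" "\<And>n. u \<cdot> pt (\<iota> n) X = seq X Y A f n" "s = u \<cdot> pt \<Delta> X"
    using s csum_iff[OF A Ob(1,2), of f s] f by blast
  have "seq X' Y' A (\<lambda>a. \<Phi> (f a)) n = \<Phi> (seq X Y A f n)" for n by (simp add: seq_def zero)
  then show ?thesis
    using csum_iff[OF A Ob(3,4), of "\<lambda>a. \<Phi> (f a)"] Hom f lift u by (auto intro!: bexI[of _ "L u"])
qed

section \<open>Operations on hom-sets that preserve sums\<close>

lemma csum_Comp:
  assumes "csum (PS X Y) A f = Some s" "countable A" and [simp]: "X \<in> Ob C" and g: "g \<in> Hom C Y Z"
  shows "csum (PS X Z) A (\<lambda>a. g \<cdot> f a) = Some (g \<cdot> s)"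
proof -
  have [simp]: "g \<in> Arr C" "Dom C g = Y" "Cod C g = Z" using g by (auto simp: Hom_def)
  then have [simp]: "Y \<in> Ob C" "Z \<in> Ob C" using Dom_Ob Cod_Ob by blast+
  show ?thesis
    by (rule csum_lift[OF assms(1,2), of _ _ "\<lambda>f. g \<cdot> f" "\<lambda>u. g \<cdot> u"])
      (use Comp_Zero[OF _ g] in \<open>auto simp: Hom_def\<close>)
qed

text \<open>A witness for \<open>f\<close> has \<open>D\<close> next to \<open>X\<close>, while the
  new one must have \<open>D\<close> as its last factor; \<open>swap\<close> mediates, and
  \<open>swap_pt\<close> carries the points along.\<close>

lemma csum_Tens_Idt:
  assumes "csum (PS X Y) A f = Some s" "countable A" and [simp]: "X \<in> Ob C" "Y \<in> Ob C" "Z \<in> Ob C"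
  shows "csum (PS (X \<odot> Z) (Y \<odot> Z)) A (\<lambda>a. f a \<otimes> Idt C Z) = Some (s \<otimes> Idt C Z)"
proof (rule csum_lift[OF assms(1,2), of _ _ "\<lambda>f. f \<otimes> Idt C Z" "\<lambda>u. (u \<otimes> Idt C Z) \<cdot> swap X Z D"])
  show "((u \<otimes> Idt C Z) \<cdot> swap X Z D) \<cdot> pt p (X \<odot> Z) = (u \<cdot> pt p X) \<otimes> Idt C Z"
    if "u \<in> Hom C (X \<odot> D) Y" "p \<in> Hom C (Unit C) D" for u p
    using that(1) that(2)[unfolded Hom_def] by (simp add: swap_pt[OF that(2)] pt_arr[OF that(2)] Hom_def)
qed (use Zero_Tens[OF Idt_Hom] in \<open>auto simp: Hom_def\<close>)

text \<open>Zero absorbs tensoring and composition, so the zero morphism into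
  \<open>Y \<leadsto> Z\<close> evaluates to zero; transposes are unique.\<close>

lemma cur_Zero:
  assumes [simp]: "X \<in> Ob C" "Y \<in> Ob C" "Z \<in> Ob C"
  shows "cur C X Y (Zero C (X \<odot> Y) Z) = Zero C X (Y \<leadsto> Z)"
proof -
  have "Ev C Y Z \<cdot> (Zero C X (Y \<leadsto> Z) \<otimes> Idt C Y) = Zero C (X \<odot> Y) Z"
    using Zero_Tens[OF Idt_Hom, of Y X "Y \<leadsto> Z"] Comp_Zero[of "X \<odot> Y" "Ev C Y Z"] by (simp add: Hom_def)
  then show ?thesis
    using cur_Ev[of "Zero C X (Y \<leadsto> Z)" X Y Z] Zero_Hom[of X "Y \<leadsto> Z"] by (simp add: Hom_def)
qed

text \<open>A witness is first reordered so that \<open>Y\<close> comes last and then transposed.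
  Composing with a point commutes with this by \<open>cur_Comp\<close> and
  \<open>swap_pt'\<close>.\<close>

lemma csum_cur:
  assumes "csum (PS (X \<odot> Y) Z) A f = Some s" "countable A"
    and [simp]: "X \<in> Ob C" "Y \<in> Ob C" "Z \<in> Ob C"
  shows "csum (PS X (Y \<leadsto> Z)) A (\<lambda>a. cur C X Y (f a)) = Some (cur C X Y s)"
proof (rule csum_lift[OF assms(1,2), of _ _ "cur C X Y" "\<lambda>u. cur C (X \<odot> D) Y (u \<cdot> swap X D Y)"])
  show "cur C (X \<odot> D) Y (u \<cdot> swap X D Y) \<cdot> pt p X = cur C X Y (u \<cdot> pt p (X \<odot> Y))"
    if u: "u \<in> Hom C ((X \<odot> Y) \<odot> D) Z" and p: "p \<in> Hom C (Unit C) D" for u p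
    using u by (simp add: cur_Comp swap_pt'[OF p] pt_arr[OF p] Hom_def)
qed (auto simp: Hom_def cur_Zero)

section \<open>Double families and the tensor product\<close>

lemma csum_Tens:
  assumes f: "csum (PS X Y) A f = Some s" and g: "csum (PS X' Y') B g = Some t"
    and A: "countable A" and B: "countable B"
    and [simp]: "X \<in> Ob C" "Y \<in> Ob C" "X' \<in> Ob C" "Y' \<in> Ob C"
  shows "csum (PS (X \<odot> X') (Y \<odot> Y')) (A \<times> B) (\<lambda>(a, b). f a \<otimes> g b) = Some (s \<otimes> t)"
proof -
  interpret P: pcm "Hom C (X \<odot> X') (Y \<odot> Y')" "PS (X \<odot> X') (Y \<odot> Y')" by (rule PS_pcm) simp_all
  note fH = csum_Hom(2)[OF f A] and gH = csum_Hom(2)[OF g B]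
  let ?f = "seq X Y A f" and ?g = "seq X' Y' B g"
  have fN: "?f n \<in> Hom C X Y" and gN: "?g n \<in> Hom C X' Y'" for n
    using seq_Hom[OF A, of f X Y n] seq_Hom[OF B, of g X' Y' n] fH gH by auto
  obtain u where u: "u \<in> Hom C (X \<odot> D) Y" "\<And>n. u \<cdot> pt (\<iota> n) X = ?f n" "s = u \<cdot> pt \<Delta> X"
    using f csum_iff[OF A, of X Y f] fH by auto
  obtain v where v: "v \<in> Hom C (X' \<odot> D) Y'" "\<And>n. v \<cdot> pt (\<iota> n) X' = ?g n" "t = v \<cdot> pt \<Delta> X'"
    using g csum_iff[OF B, of X' Y' g] gH by auto
  have [simp]: "u \<in> Arr C" "Dom C u = X \<odot> D" "Cod C u = Y" "v \<in> Arr C" "Dom C v = X' \<odot> D" "Cod C v = Y'"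
    using u(1) v(1) by (auto simp: Hom_def)
  \<comment> \<open>The first copy of \<open>D\<close> is moved beside \<open>X\<close> and the
    second grouped with \<open>X'\<close>, so that they feed \<open>u\<close> and \<open>v\<close>
    respectively.\<close>
  let ?w = "(u \<otimes> v) \<cdot> Assoc C (X \<odot> D) X' D \<cdot> (swap X X' D \<otimes> Idt C D)"
  let ?F = "\<lambda>(i, j). ?f i \<otimes> ?g j"
  \<comment> \<open>By naturality \<open>pt q\<close> slides past the swap; \<open>Assoc_pt\<close>
    then places \<open>q\<close> beside \<open>X'\<close>, and \<open>swap_pt\<close> places
    \<open>p\<close> beside \<open>X\<close>.\<close>
  have w: "?w \<cdot> pt q ((X \<odot> X') \<odot> D) \<cdot> pt p (X \<odot> X') = (u \<cdot> pt p X) \<otimes> (v \<cdot> pt q X')"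
    if p: "p \<in> Hom C (Unit C) D" and q: "q \<in> Hom C (Unit C) D" for p q
  proof -
    note [simp] = pt_arr[OF p] pt_arr[OF q]
    have "?w \<cdot> pt q ((X \<odot> X') \<odot> D) \<cdot> pt p (X \<odot> X') =
        (u \<otimes> v) \<cdot> Assoc C (X \<odot> D) X' D \<cdot> pt q ((X \<odot> D) \<odot> X') \<cdot> swap X X' D \<cdot> pt p (X \<odot> X')"
      using Comp_eq_assoc[OF pt_nat[OF q, of "swap X X' D" "(X \<odot> D) \<odot> X'"], of "pt p (X \<odot> X')"] by simp
    also have "\<dots> = (u \<otimes> v) \<cdot> (Idt C (X \<odot> D) \<otimes> pt q X') \<cdot> (pt p X \<otimes> Idt C X')"
      using Comp_eq_assoc[OF Assoc_pt[OF q, of "X \<odot> D" X'], of "pt p X \<otimes> Idt C X'"]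
      by (simp add: swap_pt[OF p])
    finally show ?thesis by simp
  qed
  have wH: "?w \<in> Hom C (((X \<odot> X') \<odot> D) \<odot> D) (Y \<odot> Y')" by (simp add: Hom_def)
  have "csum (PS (X \<odot> X') (Y \<odot> Y')) UNIV ?F = Some (s \<otimes> t)"
    using csum_UNIV2[OF _ _ wH, of ?F] w u v by simp
  \<comment> \<open>A pair outside the rectangle of codes has a padded component, and the zero
    morphism absorbs tensoring.\<close>
  moreover have "csum (PS (X \<odot> X') (Y \<odot> Y')) UNIV ?F =
      csum (PS (X \<odot> X') (Y \<odot> Y')) (to_nat_on A ` A \<times> to_nat_on B ` B) ?F"
  proof (rule P.csum_extend[where z = "Zero C (X \<odot> X') (Y \<odot> Y')"])
    fix ij :: "nat \<times> nat"
    assume "ij \<in> UNIV - to_nat_on A ` A \<times> to_nat_on B ` B"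
    moreover obtain i j where "ij = (i, j)" by force
    ultimately have "?f i = Zero C X Y \<or> ?g j = Zero C X' Y'" by (auto simp: seq_def)
    then show "?F ij = Zero C (X \<odot> X') (Y \<odot> Y')"
      using Tens_Zero[OF fN] Zero_Tens[OF gN] \<open>ij = (i, j)\<close> by auto
  qed (auto simp: PS_empty)
  moreover have "\<dots> = csum (PS (X \<odot> X') (Y \<odot> Y')) (A \<times> B) (?F \<circ> map_prod (to_nat_on A) (to_nat_on B))"
    by (rule P.csum_reindex[symmetric])
      (use A B in \<open>auto intro!: bij_betw_map_prod inj_on_imp_bij_betw\<close>)
  moreover have "\<dots> = csum (PS (X \<odot> X') (Y \<odot> Y')) (A \<times> B) (\<lambda>(a, b). f a \<otimes> g b)"
    by (rule P.csum_cong) (use A B in \<open>auto simp: seq_to_nat_on\<close>)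
  ultimately show ?thesis by simp
qed

lemma tensor_compatible: "compatible_with_tensor C PS TYPE('a) TYPE('b)"
  unfolding compatible_with_tensor_def kleene_le_def
  by (auto simp: bind_eq_Some_conv intro: csum_Tens)

section \<open>Closed structure\<close>

lemma csum_cur_iff:
  assumes [simp]: "X \<in> Ob C" "Y \<in> Ob C" "Z \<in> Ob C"
    and A: "countable A" and f: "\<And>a. a \<in> A \<Longrightarrow> f a \<in> Hom C (X \<odot> Y) Z"
  shows "csum (PS X (Y \<leadsto> Z)) A (\<lambda>a. cur C X Y (f a)) = map_option (cur C X Y) (csum (PS (X \<odot> Y) Z) A f)"
proof (cases "csum (PS X (Y \<leadsto> Z)) A (\<lambda>a. cur C X Y (f a))")
  case None
  then show ?thesis using csum_cur[OF _ A, of X Y Z f] by (cases "csum (PS (X \<odot> Y) Z) A f") auto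
next
  case (Some s)
  interpret P: pcm "Hom C (X \<odot> Y) Z" "PS (X \<odot> Y) Z" by (rule PS_pcm) simp_all
  \<comment> \<open>Uncurrying is tensoring with \<open>Y\<close> followed by evaluation, and both
    preserve sums; so summability of the transposes passes back to \<open>f\<close>.\<close>
  have "csum (PS (X \<odot> Y) Z) A (\<lambda>a. Ev C Y Z \<cdot> (cur C X Y (f a) \<otimes> Idt C Y)) = Some (Ev C Y Z \<cdot> (s \<otimes> Idt C Y))"
    by (rule csum_Comp[OF csum_Tens_Idt[OF Some A] A]) (simp_all add: Ev_Hom)
  moreover have "csum (PS (X \<odot> Y) Z) A (\<lambda>a. Ev C Y Z \<cdot> (cur C X Y (f a) \<otimes> Idt C Y)) = csum (PS (X \<odot> Y) Z) A f"
    by (rule P.csum_cong[OF A]) (use f in \<open>simp add: Hom_def Ev_cur\<close>)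
  moreover have "cur C X Y (Ev C Y Z \<cdot> (s \<otimes> Idt C Y)) = s"
    using csum_Hom(1)[OF Some A] by (simp add: cur_Ev Hom_def)
  ultimately show ?thesis using Some by simp
qed

lemma closed_compatible: "compatible_with_closed C PS TYPE('a) TYPE('b)"
  unfolding compatible_with_closed_def
  by (intro conjI ballI allI impI) (simp_all add: tensor_compatible csum_cur_iff kleene_eq_def kleene_le_def)

section \<open>Cartesian products\<close>

lemma csum_tuple:
  assumes P: "is_product C I Y P p" and X: "X \<in> Ob C" and A: "countable A"
    and f: "\<And>i a. \<lbrakk>i \<in> I; a \<in> A\<rbrakk> \<Longrightarrow> f i a \<in> Hom C X (Y i)"
    and s: "\<And>i. i \<in> I \<Longrightarrow> csum (PS X (Y i)) A (f i) = Some (s i)"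
  shows "csum (PS X P) A (\<lambda>a. tuple C I P p X (\<lambda>i. f i a)) = Some (tuple C I P p X s)"
proof -
  have PO: "P \<in> Ob C" using P by (simp add: is_product_def)
  have p: "Y i \<in> Ob C" "p i \<in> Hom C P (Y i)" if "i \<in> I" for i
    using P that by (auto simp: is_product_def)
  let ?t = "\<lambda>a. tuple C I P p X (\<lambda>i. f i a)"
  have XD: "X \<odot> D \<in> Ob C" using X by simp
  have "\<forall>i\<in>I. \<exists>u. u \<in> Hom C (X \<odot> D) (Y i) \<and> (\<forall>n. u \<cdot> pt (\<iota> n) X = seq X (Y i) A (f i) n) \<and> s i = u \<cdot> pt \<Delta> X"
  proof
    fix i assume i: "i \<in> I"
    show "\<exists>u. u \<in> Hom C (X \<odot> D) (Y i) \<and> (\<forall>n. u \<cdot> pt (\<iota> n) X = seq X (Y i) A (f i) n) \<and> s i = u \<cdot> pt \<Delta> X"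
      using csum_iff[OF A X p(1)[OF i], of "f i" "s i"] f[OF i] s[OF i] by blast
  qed
  then obtain u where u: "\<And>i. i \<in> I \<Longrightarrow> u i \<in> Hom C (X \<odot> D) (Y i)"
    "\<And>i n. i \<in> I \<Longrightarrow> u i \<cdot> pt (\<iota> n) X = seq X (Y i) A (f i) n" "\<And>i. i \<in> I \<Longrightarrow> s i = u i \<cdot> pt \<Delta> X"
    by metis
  \<comment> \<open>The witnesses of the components share the domain \<open>X \<odot> D\<close>, so
    the universal property joins them into one arrow, whose composites with points are then compared
    componentwise.\<close>
  let ?u = "tuple C I P p (X \<odot> D) u"
  have t: "?t a \<in> Hom C X P" "\<And>i. i \<in> I \<Longrightarrow> p i \<cdot> ?t a = f i a" if "a \<in> A" for a
    using tuple_props[OF P X, of "\<lambda>i. f i a"] f that by auto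
  have uH: "?u \<in> Hom C (X \<odot> D) P" and pu: "\<And>i. i \<in> I \<Longrightarrow> p i \<cdot> ?u = u i"
    using tuple_props[OF P XD, of u] u(1) by auto
  have pt_Hom: "pt q X \<in> Hom C X (X \<odot> D)" if "q \<in> Hom C (Unit C) D" for q
    using that X pt_arr[OF that X] by (simp add: Hom_def)
  have u_pt: "p i \<cdot> ?u \<cdot> pt q X = u i \<cdot> pt q X" if "i \<in> I" "q \<in> Hom C (Unit C) D" for i q
    using Comp_assoc[OF pt_Hom[OF that(2)] uH p(2)[OF that(1)]] pu that by simp
  \<comment> \<open>Both sides are the tuple of the padded components: each \<open>p i\<close> sends
    the padding of \<open>?t\<close> to that of \<open>f i\<close>, because zero absorbs
    composition.\<close>
  have "?u \<cdot> pt (\<iota> n) X = seq X P A ?t n" for n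
  proof -
    have "seq X P A ?t n \<in> Hom C X P" using seq_Hom[OF A _ X PO, of ?t] t(1) by blast
    moreover have "p i \<cdot> seq X P A ?t n = seq X (Y i) A (f i) n" if "i \<in> I" for i
      using t(2)[OF _ that] Comp_Zero[OF X p(2)[OF that]] that A by (auto simp: seq_def)
    ultimately have "tuple C I P p X (\<lambda>i. seq X (Y i) A (f i) n) = seq X P A ?t n"
      by (rule tuple_unique[OF P X])
    moreover have "tuple C I P p X (\<lambda>i. seq X (Y i) A (f i) n) = ?u \<cdot> pt (\<iota> n) X"
      by (rule tuple_unique[OF P X Comp_Hom[OF pt_Hom uH]]) (simp_all add: u_pt u(2))
    ultimately show ?thesis by simp
  qed
  moreover have "tuple C I P p X s = ?u \<cdot> pt \<Delta> X"
    by (rule tuple_unique[OF P X Comp_Hom[OF pt_Hom uH]]) (simp_all add: u_pt u(3))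
  ultimately show ?thesis using csum_iff[OF A X PO, of ?t] t(1) uH by auto
qed

lemma products_compatible: "compatible_with_products C PS I TYPE('a)"
  unfolding compatible_with_products_def
proof (intro allI impI ballI)
  fix Y P p X and A :: "'a set" and f
  assume P: "is_product C I Y P p" and X: "X \<in> Ob C" and A: "countable A"
    and f: "\<forall>i\<in>I. \<forall>a\<in>A. f i a \<in> Hom C X (Y i)"
  have p: "Y i \<in> Ob C" "p i \<in> Hom C P (Y i)" if "i \<in> I" for i
    using P that by (auto simp: is_product_def)
  let ?l = "csum (PS X P) A (\<lambda>a. tuple C I P p X (\<lambda>i. f i a))"
  let ?s = "\<lambda>i. the (csum (PS X (Y i)) A (f i))"
  have 1: "?l = Some (tuple C I P p X ?s)" if "\<forall>i\<in>I. csum (PS X (Y i)) A (f i) \<noteq> None"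
    by (rule csum_tuple[OF P X A]) (use f that in auto)
  \<comment> \<open>Postcomposition with \<open>p i\<close> preserves sums and recovers
    \<open>f i\<close> from the tuples, so definedness on the left passes to every
    component.\<close>
  have 2: "csum (PS X (Y i)) A (f i) \<noteq> None" if s: "?l = Some s" and i: "i \<in> I" for s i
  proof -
    have "csum (PS X (Y i)) A (f i) = csum (PS X (Y i)) A (\<lambda>a. p i \<cdot> tuple C I P p X (\<lambda>i. f i a))"
      by (rule pcm.csum_cong[OF PS_pcm[OF X p(1)[OF i]] A])
        (use tuple_props(2)[OF P X _ i] f in auto)
    then show ?thesis using csum_Comp[OF s A X p(2)[OF i]] by simp
  qed
  show "?l \<simeq> (if \<forall>i\<in>I. csum (PS X (Y i)) A (f i) \<noteq> None then Some (tuple C I P p X ?s) else None)"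
  proof (cases "\<forall>i\<in>I. csum (PS X (Y i)) A (f i) \<noteq> None")
    case True
    then show ?thesis using 1 by (simp add: kleene_eq_def kleene_le_def)
  next
    case False
    then have "?l = None" using 2 by (cases ?l) auto
    then show ?thesis using False by (auto simp: kleene_eq_def kleene_le_def)
  qed
qed

end

theorem theorem6p5:
  fixes C :: "('o, 'm, 'z) smcc_scheme"
    and D :: 'o and \<iota> :: "nat \<Rightarrow> 'm" and \<Delta> :: 'm
    and PS :: "'o \<Rightarrow> 'o \<Rightarrow> 'm psum"
  assumes "representable_smcc C D \<iota> \<Delta> PS"
  shows "compatible_with_tensor C PS TYPE('a) TYPE('b)
       \<and> compatible_with_closed C PS TYPE('a) TYPE('b)
       \<and> (\<forall>I :: 'i set. countable I \<longrightarrow> compatible_with_products C PS I TYPE('a))"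
  using representable_smcc.tensor_compatible[OF assms] representable_smcc.closed_compatible[OF assms]
    representable_smcc.products_compatible[OF assms] by blast

end
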